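(* Suppose the Markov decision model $(X,A,\{A(x):x\in X\},Q,C)$ with discount factor $\alpha\in(0,1)$ satisfies the growth conditions (G) and the compactness-continuity conditions (K) stated in the context. Let $f_0\in\mathbb{F}$ be an arbitrary stationary policy and let $\{f_n\}$, $\{v_n\}$ be the policies and policy iteration functions generated by the policy iteration algorithm started at $f_0$; that is, for every $n\in\mathbb{N}_0$, $v_n:=V_{f_n}$, and $f_{n+1}\in\mathbb{F}$ is a selector with $Tv_n^e=T_{f_{n+1}}v_n^e$. Then: (a) $v_n\ge v_n^e\ge Tv_n^e\ge v_{n+1}\ge v_{n+1}^e$ for all $n\in\mathbb{N}_0$; (b) if $v_n^e=v_{n+1}$, then $v_n^e=V_\ast$ and $f_{n+1}$ is an optimal policy; (c) $V_\ast=\lim_{n\to\infty}v_n=\lim_{n\to\infty}v_n^e=\lim_{n\to\infty}Tv_n^e$ (pointwise on $X$).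
   Context: Model. $X$ (states) and $A$ (actions) are Borel spaces, i.e. Borel subsets of complete separable metric spaces. For each $x\in X$, $A(x)\subset A$ is the set of admissible actions; $\mathbb{K}:=\{(x,a):x\in X,a\in A(x)\}$ is a Borel subset of $X\times A$. $Q$ is a stochastic kernel on $X$ given $\mathbb{K}$: $Q(\cdot|x,a)$ is a probability measure on $X$ for each $(x,a)\in\mathbb{K}$, and $Q(B|\cdot,\cdot)$ is Borel measurable on $\mathbb{K}$ for each Borel $B\subset X$. The one-step cost $C:\mathbb{K}\to\mathbb{R}$ is Borel measurable. $\alpha\in(0,1)$ is a fixed discount factor. $\mathbb{N}_0=\{0,1,2,\ldots\}$. Policies. $H_0:=X$ and $H_n$ is the set of histories $h_n=(x_0,a_0,\ldots,x_{n-1},a_{n-1},x_n)$ with $(x_k,a_k)\in\mathbb{K}$ for $k<n$ and $x_n\in X$. A policy is a sequence $\pi=\{\pi_n\}_{n\ge 0}$ of stochastic kernels $\pi_n$ on $A$ given $H_n$ with $\pi_n(A(x_n)|h_n)=1$ for all $h_n\in H_n$; $\Pi$ is the class of all policies. $\mathbb{F}$ is the class of measurable functions $f:X\to A$ with $f(x)\in A(x)$ for all $x\in X$; $f\in\mathbb{F}$ is identified with the stationary policy for which $\pi_n(\cdot|h_n)$ is concentrated at $f(x_n)$. For $\pi\in\Pi$ and $x\in X$, $P_x^\pi$ is the unique probability measure on $(X\times A)^\infty$ (product $\sigma$-algebra) with $P_x^\pi[x_0=x]=1$, $P_x^\pi[a_n\in D|h_n]=\pi_n(D|h_n)$, $P_x^\pi[x_{n+1}\in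 B|h_n,a_n]=Q(B|x_n,a_n)$; $E_x^\pi$ is its expectation. The discounted cost is $V_\pi(x):=E_x^\pi\sum_{k=0}^\infty\alpha^kC(x_k,a_k)$, and the optimal value function is $V_\ast(x):=\inf_{\pi\in\Pi}V_\pi(x)$. A policy $\pi$ is optimal if $V_\pi(x)=V_\ast(x)$ for all $x\in X$. Growth conditions (G). There exist constants $M>0$, $\beta>1$ and a function $W:X\to[1,\infty)$ such that: $|C(x,a)|\le MW(x)$ for all $(x,a)\in\mathbb{K}$; $QW(x,a):=\int_XW(y)Q(dy|x,a)\le\beta W(x)$ for all $(x,a)\in\mathbb{K}$; and $\gamma:=\beta\alpha<1$. Compactness-continuity conditions (K). The multifunction $x\mapsto A(x)$ is upper semicontinuous and compact-valued; $C$ is lower semicontinuous on $\mathbb{K}$; $Q$ is weakly continuous on $\mathbb{K}$, i.e. $(x,a)\mapsto\int_Xu(y)Q(dy|x,a)$ is continuous on $\mathbb{K}$ for each bounded continuous $u:X\to\mathbb{R}$; and the functions $W$ and $QW$ (with $W$ the function in (G)) are continuous. Operators. $\|u\|_W:=\sup_{x\in X}|u(x)|/W(x)$, and $B_W(X)$ is the class of measurable $u:X\to\mathbb{R}$ with $\|u\|_W<\infty$. For $u\in B_W(X)$, $Qu(x,a):=\int_Xu(y)Q(dy|x,a)$, and for $f\in\mathbb{F}$, $T_fu(x):=C(x,f(x))+\alpha Qu(x,f(x))$; also $Tu(x):=\inf_{a\in A(x)}[C(x,a)+\alpha Qu(x,a)]$, $x\in X$. Lower semicontinuous envelope. For $u:X\to\mathbb{R}$,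 $u^e(x):=\sup_{r>0}\inf_{y\in B_r(x)}u(y)$, where $B_r(x)$ is the open ball in $X$ of radius $r$ centered at $x$. Inequalities and equalities between functions are pointwise on $X$. *)

theory Defs
  imports "HOL-Probability.Probability"
begin

section \<open>Markov decision models\<close>

abbreviation borel_on :: "'a::topological_space set \<Rightarrow> 'a measure" where
  "borel_on S \<equiv> restrict_space borel S"

record ('x, 'a) mdm =
  states :: "'x set"
  actions :: "'a set"
  adm :: "'x \<Rightarrow> 'a set"
  tr_kernel :: "'x \<times> 'a \<Rightarrow> 'x measure"
  cost :: "'x \<times> 'a \<Rightarrow> real"
  discount :: real

definition graph :: "('x, 'a) mdm \<Rightarrow> ('x \<times> 'a) set" where
  "graph D = Sigma (states D) (adm D)"

text \<open>The components are total functions in HOL; only the values of \<^term>\<open>adm D\<close> on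
  \<^term>\<open>states D\<close> and of \<^term>\<open>tr_kernel D\<close> and \<^term>\<open>cost D\<close> on \<^term>\<open>graph D\<close> matter.\<close>

definition markov_decision_model :: "('x::polish_space, 'a::polish_space) mdm \<Rightarrow> bool" where
  "markov_decision_model D \<longleftrightarrow>
     states D \<in> sets borel \<and>
     actions D \<in> sets borel \<and>
     (\<forall>x\<in>states D. adm D x \<subseteq> actions D) \<and>
     graph D \<in> sets (borel_on (states D) \<Otimes>\<^sub>M borel_on (actions D)) \<and>
     tr_kernel D \<in> borel_on (graph D) \<rightarrow>\<^sub>M prob_algebra (borel_on (states D)) \<and>
     cost D \<in> borel_measurable (borel_on (graph D)) \<and>
     0 < discount D \<and> discount D < 1"


section \<open>Policies\<close>

text \<open>A history \<open>(x\<^sub>0, a\<^sub>0, \<dots>, x\<^sub>n\<^sub>-\<^sub>1, a\<^sub>n\<^sub>-\<^sub>1, x\<^sub>n)\<close> is encoded as the pair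
  \<open>((x\<^sub>k, a\<^sub>k)\<^sub>k\<^sub><\<^sub>n, x\<^sub>n)\<close>; \<open>hist_space D n\<close> is the set \<open>H\<^sub>n\<close> with its Borel \<open>\<sigma>\<close>-algebra.\<close>

definition hist_space ::
  "('x::polish_space, 'a::polish_space) mdm \<Rightarrow> nat \<Rightarrow> ((nat \<Rightarrow> 'x \<times> 'a) \<times> 'x) measure" where
  "hist_space D n = (\<Pi>\<^sub>M k\<in>{..<n}. borel_on (graph D)) \<Otimes>\<^sub>M borel_on (states D)"

type_synonym ('x, 'a) policy = "nat \<Rightarrow> (nat \<Rightarrow> 'x \<times> 'a) \<times> 'x \<Rightarrow> 'a measure"

definition policies :: "('x::polish_space, 'a::polish_space) mdm \<Rightarrow> ('x, 'a) policy set" where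
  "policies D = {\<pi>. \<forall>n.
     \<pi> n \<in> hist_space D n \<rightarrow>\<^sub>M prob_algebra (borel_on (actions D)) \<and>
     (\<forall>h\<in>space (hist_space D n). measure (\<pi> n h) (adm D (snd h)) = 1)}"

definition selectors :: "('x::polish_space, 'a::polish_space) mdm \<Rightarrow> ('x \<Rightarrow> 'a) set" where
  "selectors D = {f. f \<in> borel_on (states D) \<rightarrow>\<^sub>M borel_on (actions D) \<and>
     (\<forall>x\<in>states D. f x \<in> adm D x)}"

definition stationary ::
  "('x::polish_space, 'a::polish_space) mdm \<Rightarrow> ('x \<Rightarrow> 'a) \<Rightarrow> ('x, 'a) policy" where
  "stationary D f = (\<lambda>n h. return (borel_on (actions D)) (f (snd h)))"


section \<open>The process induced by a policy\<close>

definition state_action_space ::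
  "('x::polish_space, 'a::polish_space) mdm \<Rightarrow> ('x \<times> 'a) measure" where
  "state_action_space D = borel_on (states D) \<Otimes>\<^sub>M borel_on (actions D)"

definition traj_space ::
  "('x::polish_space, 'a::polish_space) mdm \<Rightarrow> (nat \<Rightarrow> 'x \<times> 'a) measure" where
  "traj_space D = (\<Pi>\<^sub>M k\<in>UNIV. state_action_space D)"

definition history :: "nat \<Rightarrow> (nat \<Rightarrow> 'x \<times> 'a) \<Rightarrow> (nat \<Rightarrow> 'x \<times> 'a) \<times> 'x" where
  "history n \<omega> = (restrict \<omega> {..<n}, fst (\<omega> n))"

text \<open>Along a trajectory in \<open>(X \<times> A)\<^sup>\<infinity>\<close> the history lies in \<open>(X \<times> A)\<^sup>n \<times> X\<close>; it lies in
  \<open>H\<^sub>n\<close> only almost surely.\<close>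

definition full_hist_space ::
  "('x::polish_space, 'a::polish_space) mdm \<Rightarrow> nat \<Rightarrow> ((nat \<Rightarrow> 'x \<times> 'a) \<times> 'x) measure" where
  "full_hist_space D n = (\<Pi>\<^sub>M k\<in>{..<n}. state_action_space D) \<Otimes>\<^sub>M borel_on (states D)"

text \<open>The \<open>\<sigma>\<close>-algebras generated by \<open>h\<^sub>n\<close> and by \<open>(h\<^sub>n, a\<^sub>n)\<close>.\<close>

definition sigma_hist ::
  "('x::polish_space, 'a::polish_space) mdm \<Rightarrow> nat \<Rightarrow> (nat \<Rightarrow> 'x \<times> 'a) measure" where
  "sigma_hist D n =
     vimage_algebra (space (traj_space D)) (history n) (full_hist_space D n)"

definition sigma_hist_action ::
  "('x::polish_space, 'a::polish_space) mdm \<Rightarrow> nat \<Rightarrow> (nat \<Rightarrow> 'x \<times> 'a) measure" where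
  "sigma_hist_action D n =
     vimage_algebra (space (traj_space D)) (\<lambda>\<omega>. (history n \<omega>, snd (\<omega> n)))
       (full_hist_space D n \<Otimes>\<^sub>M borel_on (actions D))"

text \<open>The defining properties of \<open>P\<^sub>x\<^sup>\<pi>\<close>; conditional probabilities are conditional
  expectations of indicators and hence determined almost surely.\<close>

definition is_policy_measure ::
  "('x::polish_space, 'a::polish_space) mdm \<Rightarrow> ('x, 'a) policy \<Rightarrow> 'x
     \<Rightarrow> (nat \<Rightarrow> 'x \<times> 'a) measure \<Rightarrow> bool" where
  "is_policy_measure D \<pi> x P \<longleftrightarrow>
     prob_space P \<and>
     sets P = sets (traj_space D) \<and>
     measure P {\<omega> \<in> space P. fst (\<omega> 0) = x} = 1 \<and>
     (\<forall>n. \<forall>B\<in>sets (borel_on (actions D)). AE \<omega> in P.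
        real_cond_exp P (sigma_hist D n) (indicat_real {\<omega> \<in> space P. snd (\<omega> n) \<in> B}) \<omega>
        = measure (\<pi> n (history n \<omega>)) B) \<and>
     (\<forall>n. \<forall>B\<in>sets (borel_on (states D)). AE \<omega> in P.
        real_cond_exp P (sigma_hist_action D n)
          (indicat_real {\<omega> \<in> space P. fst (\<omega> (Suc n)) \<in> B}) \<omega>
        = measure (tr_kernel D (\<omega> n)) B)"

definition policy_measure ::
  "('x::polish_space, 'a::polish_space) mdm \<Rightarrow> ('x, 'a) policy \<Rightarrow> 'x
     \<Rightarrow> (nat \<Rightarrow> 'x \<times> 'a) measure" where
  "policy_measure D \<pi> x = (THE P. is_policy_measure D \<pi> x P)"


section \<open>Discounted cost and optimality\<close>

text \<open>The cost is specified on \<^term>\<open>graph D\<close> only. It is extended by zero to keep the integrand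
  measurable on all of \<open>(X \<times> A)\<^sup>\<infinity>\<close>; since \<open>(x\<^sub>k, a\<^sub>k)\<close> lies in \<^term>\<open>graph D\<close> almost surely
  for all \<open>k\<close>, the extension does not affect the value.\<close>

definition policy_value ::
  "('x::polish_space, 'a::polish_space) mdm \<Rightarrow> ('x, 'a) policy \<Rightarrow> 'x \<Rightarrow> real" where
  "policy_value D \<pi> x =
     (\<integral>\<omega>. (\<Sum>k. discount D ^ k * (if \<omega> k \<in> graph D then cost D (\<omega> k) else 0))
        \<partial>policy_measure D \<pi> x)"

definition optimal_value :: "('x::polish_space, 'a::polish_space) mdm \<Rightarrow> 'x \<Rightarrow> real" where
  "optimal_value D x = (INF \<pi>\<in>policies D. policy_value D \<pi> x)"

definition optimal_policy ::
  "('x::polish_space, 'a::polish_space) mdm \<Rightarrow> ('x, 'a) policy \<Rightarrow> bool" where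
  "optimal_policy D \<pi> \<longleftrightarrow>
     \<pi> \<in> policies D \<and> (\<forall>x\<in>states D. policy_value D \<pi> x = optimal_value D x)"


section \<open>Operators\<close>

definition Qop :: "('x, 'a) mdm \<Rightarrow> ('x \<Rightarrow> real) \<Rightarrow> 'x \<times> 'a \<Rightarrow> real" where
  "Qop D u z = (\<integral>y. u y \<partial>tr_kernel D z)"

definition Tsel :: "('x, 'a) mdm \<Rightarrow> ('x \<Rightarrow> 'a) \<Rightarrow> ('x \<Rightarrow> real) \<Rightarrow> 'x \<Rightarrow> real" where
  "Tsel D f u x = cost D (x, f x) + discount D * Qop D u (x, f x)"

definition Top :: "('x, 'a) mdm \<Rightarrow> ('x \<Rightarrow> real) \<Rightarrow> 'x \<Rightarrow> real" where
  "Top D u x = (INF a\<in>adm D x. cost D (x, a) + discount D * Qop D u (x, a))"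

text \<open>The infimum over a large ball may be \<open>-\<infinity>\<close>, so the envelope is computed in the extended
  reals. Its value is finite whenever \<open>u\<close> is bounded below near \<open>x\<close>, in particular when
  \<open>|u| \<le> c W\<close> for a constant \<open>c\<close> and a continuous \<open>W\<close>.\<close>

definition lsc_envelope :: "'x::metric_space set \<Rightarrow> ('x \<Rightarrow> real) \<Rightarrow> 'x \<Rightarrow> real" where
  "lsc_envelope X u x =
     real_of_ereal (SUP r\<in>{0::real<..}. INF y\<in>ball x r \<inter> X. ereal (u y))"


section \<open>Growth and compactness-continuity conditions\<close>

definition growth_conditions ::
  "('x, 'a) mdm \<Rightarrow> real \<Rightarrow> real \<Rightarrow> ('x \<Rightarrow> real) \<Rightarrow> bool" where
  "growth_conditions D M \<beta> W \<longleftrightarrow>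
     0 < M \<and> 1 < \<beta> \<and> (\<forall>x\<in>states D. 1 \<le> W x) \<and>
     (\<forall>(x, a)\<in>graph D. \<bar>cost D (x, a)\<bar> \<le> M * W x) \<and>
     (\<forall>(x, a)\<in>graph D. integrable (tr_kernel D (x, a)) W \<and> Qop D W (x, a) \<le> \<beta> * W x) \<and>
     \<beta> * discount D < 1"

definition upper_semicontinuous_multifunction ::
  "'x::topological_space set \<Rightarrow> 'a::topological_space set \<Rightarrow> ('x \<Rightarrow> 'a set) \<Rightarrow> bool" where
  "upper_semicontinuous_multifunction X A F \<longleftrightarrow>
     (\<forall>U. openin (top_of_set A) U \<longrightarrow> openin (top_of_set X) {x \<in> X. F x \<subseteq> U})"

definition lower_semicontinuous_on :: "'z::topological_space set \<Rightarrow> ('z \<Rightarrow> real) \<Rightarrow> bool" where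
  "lower_semicontinuous_on S g \<longleftrightarrow>
     (\<forall>z\<in>S. \<forall>c<g z. eventually (\<lambda>w. c < g w) (at z within S))"

definition weakly_continuous_kernel ::
  "('x::topological_space, 'a::topological_space) mdm \<Rightarrow> bool" where
  "weakly_continuous_kernel D \<longleftrightarrow>
     (\<forall>u. continuous_on (states D) u \<and> bounded (u ` states D) \<longrightarrow>
        continuous_on (graph D) (Qop D u))"

definition compactness_continuity_conditions ::
  "('x::polish_space, 'a::polish_space) mdm \<Rightarrow> ('x \<Rightarrow> real) \<Rightarrow> bool" where
  "compactness_continuity_conditions D W \<longleftrightarrow>
     upper_semicontinuous_multifunction (states D) (actions D) (adm D) \<and>
     (\<forall>x\<in>states D. compact (adm D x)) \<and>
     lower_semicontinuous_on (graph D) (cost D) \<and>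
     weakly_continuous_kernel D \<and>
     continuous_on (states D) W \<and>
     continuous_on (graph D) (Qop D W)"


section \<open>Policy iteration\<close>

definition policy_iteration ::
  "('x::polish_space, 'a::polish_space) mdm \<Rightarrow> (nat \<Rightarrow> 'x \<Rightarrow> 'a) \<Rightarrow> (nat \<Rightarrow> 'x \<Rightarrow> real) \<Rightarrow> bool"
  where
  "policy_iteration D f v \<longleftrightarrow>
     f 0 \<in> selectors D \<and>
     (\<forall>n. v n = policy_value D (stationary D (f n)) \<and>
          f (Suc n) \<in> selectors D \<and>
          (\<forall>x\<in>states D. Top D (lsc_envelope (states D) (v n)) x
                       = Tsel D (f (Suc n)) (lsc_envelope (states D) (v n)) x))"

end

theory Submission
  imports Defs
begin

text \<open>If \<open>u\<close> is dominated by \<open>W\<close> and \<open>u \<le> C + \<alpha> Q u\<close> on the graph, then telescoping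
  \<open>\<alpha>\<^sup>n E u(x\<^sub>n)\<close> along any policy gives \<open>u \<le> V\<^sub>\<pi>\<close>, and \<open>T\<^sub>f u \<le> u\<close> gives \<open>V\<^sub>f \<le> u\<close>
  in the same way. Since \<open>T\<close> preserves lower semicontinuity and \<open>T v\<^sub>n\<^sup>e \<le> T\<^bsub>f\<^sub>n\<^esub> v\<^sub>n = v\<^sub>n\<close>, the function
  \<open>T v\<^sub>n\<^sup>e\<close> is a lower semicontinuous minorant of \<open>v\<^sub>n\<close>, hence \<open>T v\<^sub>n\<^sup>e \<le> v\<^sub>n\<^sup>e\<close>; this makes the
  iteration monotone. Its limit \<open>L\<close> satisfies \<open>L \<le> C + \<alpha> Q L\<close> by dominated convergence, so
  \<open>L \<le> V\<^sub>*\<close>. The measure \<open>P\<^sub>x\<^sup>\<pi>\<close> comes from the Ionescu-Tulcea theorem, applied to kernels extended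
  to all of \<open>(X \<times> A)\<^sup>n \<times> X\<close>.\<close>

section \<open>Conditional kernels\<close>

text \<open>The envelope is there because \<open>v n\<close> need not be lower semicontinuous: the
  cost is only lower semicontinuous, the kernel only weakly continuous and the selectors only
  measurable. The envelope belongs to a class that T preserves and lies below \<open>v n\<close>, so
  nothing is lost in the comparison. A decreasing limit may leave that class, so the passage to the
  limit is made at one fixed pair (x,a), where the infimum over actions has been bounded by a single
  value. All iterates share the bound c W with c = M / (1 - \<gamma>), the sum of the terms M
  \<gamma>^k; \<gamma> = \<beta> \<alpha> bounds the factor by which discounted weighted moments
  change per step. A second obstacle is the measure: \<open>policy_measure\<close> is a
  \<open>THE\<close> over conditional expectations in which \<pi> is specified only on histories
  with admissible actions, and those are reached only almost surely. It has to be shown well defined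
  before any cost can be evaluated, and the kernel identity at time n and admissibility up to that
  time lean on each other.\<close>

text \<open>Disintegration: the joint law of \<open>Y\<close> and \<open>Z\<close> is the law of
  \<open>Y\<close> followed by the kernel \<open>K\<close>. Testing with \<open>ennreal\<close>
  integrands lets integrals be rewritten without any integrability check.\<close>

definition cond_kernel ::
  "'o measure \<Rightarrow> 's measure \<Rightarrow> ('o \<Rightarrow> 's) \<Rightarrow> 't measure \<Rightarrow> ('o \<Rightarrow> 't) \<Rightarrow> ('s \<Rightarrow> 't measure) \<Rightarrow> bool" where
  "cond_kernel P S Y T Z K \<longleftrightarrow> (\<forall>g::'s \<times> 't \<Rightarrow> ennreal. g \<in> borel_measurable (S \<Otimes>\<^sub>M T) \<longrightarrow>
     (\<integral>\<^sup>+\<omega>. g (Y \<omega>, Z \<omega>) \<partial>P) = (\<integral>\<^sup>+\<omega>. (\<integral>\<^sup>+t. g (Y \<omega>, t) \<partial>K (Y \<omega>)) \<partial>P))"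

lemma cond_kernelD:
  "cond_kernel P S Y T Z K \<Longrightarrow> (\<lambda>(s, t). g s t) \<in> borel_measurable (S \<Otimes>\<^sub>M T) \<Longrightarrow>
     (\<integral>\<^sup>+\<omega>. g (Y \<omega>) (Z \<omega>) \<partial>P) = (\<integral>\<^sup>+\<omega>. (\<integral>\<^sup>+t. g (Y \<omega>) t \<partial>K (Y \<omega>)) \<partial>P)"
  unfolding cond_kernel_def by (drule spec[where x="\<lambda>(s, t). g s t"]) auto

text \<open>Both sides integrate \<open>g\<close> against a probability measure on the product: the
  joint law \<open>\<mu>1\<close> of \<open>Y\<close> and \<open>Z\<close>, and the mixture
  \<open>\<mu>2\<close> of the Dirac mass at Y \<omega> times K (Y \<omega>). Rectangles are an
  intersection-stable generator, so agreement there suffices.\<close>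

lemma cond_kernelI_rectangles:
  fixes P :: "'o measure" and S :: "'s measure" and T :: "'t measure"
  assumes P: "prob_space P"
    and Y[measurable]: "Y \<in> P \<rightarrow>\<^sub>M S" and Z[measurable]: "Z \<in> P \<rightarrow>\<^sub>M T"
    and K: "K \<in> S \<rightarrow>\<^sub>M prob_algebra T"
    and rect: "\<And>A B. A \<in> sets S \<Longrightarrow> B \<in> sets T \<Longrightarrow>
      emeasure P {\<omega>\<in>space P. Y \<omega> \<in> A \<and> Z \<omega> \<in> B}
        = (\<integral>\<^sup>+\<omega>. indicator A (Y \<omega>) * emeasure (K (Y \<omega>)) B \<partial>P)"
  shows "cond_kernel P S Y T Z K"
proof -
  interpret prob_space P by fact
  have K'[measurable]: "K \<in> S \<rightarrow>\<^sub>M subprob_algebra T"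
    by (rule measurable_prob_algebraD[OF K])
  define R where "R \<omega> = distr (K (Y \<omega>)) (S \<Otimes>\<^sub>M T) (\<lambda>t. (Y \<omega>, t))" for \<omega>
  have R[measurable]: "R \<in> P \<rightarrow>\<^sub>M subprob_algebra (S \<Otimes>\<^sub>M T)"
    unfolding R_def[abs_def] by (rule measurable_distr2[where M=T]) measurable
  define \<mu>1 where "\<mu>1 = distr P (S \<Otimes>\<^sub>M T) (\<lambda>\<omega>. (Y \<omega>, Z \<omega>))"
  define \<mu>2 where "\<mu>2 = P \<bind> R"
  have s2: "sets \<mu>2 = sets (S \<Otimes>\<^sub>M T)"
    unfolding \<mu>2_def using not_empty by (intro sets_bind) (auto simp: R_def)
  have nn2: "(\<integral>\<^sup>+z. g z \<partial>\<mu>2) = (\<integral>\<^sup>+\<omega>. (\<integral>\<^sup>+t. g (Y \<omega>, t) \<partial>K (Y \<omega>)) \<partial>P)"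
    if g[measurable]: "g \<in> borel_measurable (S \<Otimes>\<^sub>M T)" for g :: "_ \<Rightarrow> ennreal"
    unfolding \<mu>2_def
    by (subst nn_integral_bind[OF g R])
       (auto simp: R_def intro!: nn_integral_cong nn_integral_distr
         subprob_measurableD(3)[OF K', THEN equalityD2, THEN subsetD] measurable_space[OF Y])
  have "\<mu>1 = \<mu>2"
  proof (rule measure_eqI_generator_eq[OF Int_stable_pair_measure_generator[of S T],
        where \<Omega>="space S \<times> space T" and A="\<lambda>_. space S \<times> space T"])
    show "{a \<times> b |a b. a \<in> sets S \<and> b \<in> sets T} \<subseteq> Pow (space S \<times> space T)"
      by (auto dest: sets.sets_into_space)
    show "sets \<mu>1 = sigma_sets (space S \<times> space T) {a \<times> b |a b. a \<in> sets S \<and> b \<in> sets T}"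
      by (simp add: \<mu>1_def sets_pair_measure)
    show "sets \<mu>2 = sigma_sets (space S \<times> space T) {a \<times> b |a b. a \<in> sets S \<and> b \<in> sets T}"
      by (simp add: s2 sets_pair_measure)
    show "range (\<lambda>_::nat. space S \<times> space T) \<subseteq> {a \<times> b |a b. a \<in> sets S \<and> b \<in> sets T}"
      by auto
    interpret d: prob_space \<mu>1 unfolding \<mu>1_def by (rule prob_space_distr) measurable
    show "emeasure \<mu>1 (space S \<times> space T) \<noteq> \<infinity>" by simp
    fix C assume "C \<in> {a \<times> b |a b. a \<in> sets S \<and> b \<in> sets T}"
    then obtain A B where C: "C = A \<times> B" and A[measurable]: "A \<in> sets S" and B[measurable]: "B \<in> sets T"
      by auto
    have 1: "emeasure \<mu>1 C = emeasure P {\<omega>\<in>space P. Y \<omega> \<in> A \<and> Z \<omega> \<in> B}"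
      unfolding \<mu>1_def C by (subst emeasure_distr) (auto intro!: arg_cong2[where f=emeasure])
    have "emeasure \<mu>2 C = (\<integral>\<^sup>+z. indicator C z \<partial>\<mu>2)"
      using s2 by (simp add: C)
    also have "\<dots> = (\<integral>\<^sup>+\<omega>. (\<integral>\<^sup>+t. indicator C (Y \<omega>, t) \<partial>K (Y \<omega>)) \<partial>P)"
      by (rule nn2) (simp add: C)
    also have "\<dots> = (\<integral>\<^sup>+\<omega>. indicator A (Y \<omega>) * emeasure (K (Y \<omega>)) B \<partial>P)"
    proof (rule nn_integral_cong)
      fix \<omega> assume "\<omega> \<in> space P"
      then have "sets (K (Y \<omega>)) = sets T"
        using measurable_space[OF Y] by (intro sets_kernel[OF K']) auto
      then show "(\<integral>\<^sup>+t. indicator C (Y \<omega>, t) \<partial>K (Y \<omega>)) = indicator A (Y \<omega>) * emeasure (K (Y \<omega>)) B"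
        by (simp add: C indicator_times nn_integral_cmult_indicator B)
    qed
    finally show "emeasure \<mu>1 C = emeasure \<mu>2 C"
      by (simp add: 1 rect[OF A B])
  qed simp
  show ?thesis
    unfolding cond_kernel_def
  proof safe
    fix g :: "'s \<times> 't \<Rightarrow> ennreal" assume g[measurable]: "g \<in> borel_measurable (S \<Otimes>\<^sub>M T)"
    have "(\<integral>\<^sup>+\<omega>. g (Y \<omega>, Z \<omega>) \<partial>P) = (\<integral>\<^sup>+z. g z \<partial>\<mu>1)"
      unfolding \<mu>1_def by (subst nn_integral_distr) auto
    then show "(\<integral>\<^sup>+\<omega>. g (Y \<omega>, Z \<omega>) \<partial>P) = (\<integral>\<^sup>+\<omega>. (\<integral>\<^sup>+t. g (Y \<omega>, t) \<partial>K (Y \<omega>)) \<partial>P)"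
      by (simp add: \<open>\<mu>1 = \<mu>2\<close> nn2[OF g])
  qed
qed

lemma subalgebra_vimage_algebra:
  "Y \<in> P \<rightarrow>\<^sub>M S \<Longrightarrow> subalgebra P (vimage_algebra (space P) Y S)"
  unfolding subalgebra_def
  by (auto simp: sets_vimage_algebra2 measurable_def Pi_iff)

text \<open>The sets of the generated \<sigma>-algebra are exactly the preimages under
  \<open>Y\<close> of sets in \<open>S\<close>, so the set-integral characterization of
  \<open>real_cond_exp\<close> is the rectangle identity. This links
  \<open>is_policy_measure\<close>, stated with \<open>real_cond_exp\<close>, to the disintegrations
  used for computing.\<close>

lemma cond_kernel_iff_real_cond_exp:
  fixes P :: "'o measure"
  assumes P: "prob_space P"
    and Y[measurable]: "Y \<in> P \<rightarrow>\<^sub>M S" and Z[measurable]: "Z \<in> P \<rightarrow>\<^sub>M T"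
    and K: "K \<in> S \<rightarrow>\<^sub>M prob_algebra T"
  shows "cond_kernel P S Y T Z K \<longleftrightarrow>
    (\<forall>B\<in>sets T. AE \<omega> in P. real_cond_exp P (vimage_algebra (space P) Y S)
       (indicat_real {\<omega>\<in>space P. Z \<omega> \<in> B}) \<omega> = measure (K (Y \<omega>)) B)"
proof -
  interpret prob_space P by fact
  let ?F = "vimage_algebra (space P) Y S"
  have K'[measurable]: "K \<in> S \<rightarrow>\<^sub>M subprob_algebra T"
    by (rule measurable_prob_algebraD[OF K])
  have sub: "subalgebra P ?F" by (rule subalgebra_vimage_algebra[OF Y])
  interpret sigma_finite_subalgebra P ?F
    by (intro finite_measure_subalgebra_is_sigma_finite finite_measure_subalgebra.intro
        finite_measure_subalgebra_axioms.intro sub) unfold_locales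
  have YF[measurable]: "Y \<in> ?F \<rightarrow>\<^sub>M S"
    by (rule measurable_vimage_algebra1) (use measurable_space[OF Y] in auto)
  have em: "emeasure (K (Y \<omega>)) B = ennreal (measure (K (Y \<omega>)) B)"
      "measure (K (Y \<omega>)) B \<le> 1" if "\<omega> \<in> space P" for \<omega> B
  proof -
    interpret K: prob_space "K (Y \<omega>)"
      using measurable_space[OF K measurable_space[OF Y that]] by (simp add: space_prob_algebra)
    show "emeasure (K (Y \<omega>)) B = ennreal (measure (K (Y \<omega>)) B)" "measure (K (Y \<omega>)) B \<le> 1"
      by (simp_all add: K.emeasure_eq_measure)
  qed
  have int: "integrable P (\<lambda>\<omega>. measure (K (Y \<omega>)) B)" if "B \<in> sets T" for B
    using em(2) that by (intro integrable_const_bound[of _ 1]) auto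
  have L: "emeasure P {\<omega>\<in>space P. Y \<omega> \<in> A \<and> Z \<omega> \<in> B} =
      ennreal (\<integral>\<omega>\<in>(Y -` A \<inter> space P). indicat_real {\<omega>\<in>space P. Z \<omega> \<in> B} \<omega> \<partial>P)"
    if [measurable]: "A \<in> sets S" "B \<in> sets T" for A B
  proof -
    have "(\<integral>\<omega>\<in>(Y -` A \<inter> space P). indicat_real {\<omega>\<in>space P. Z \<omega> \<in> B} \<omega> \<partial>P)
        = (\<integral>\<omega>. indicat_real {\<omega>\<in>space P. Y \<omega> \<in> A \<and> Z \<omega> \<in> B} \<omega> \<partial>P)"
      unfolding set_lebesgue_integral_def
      by (intro Bochner_Integration.integral_cong) (auto simp: indicator_def)
    then show ?thesis by (simp add: emeasure_eq_measure)
  qed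
  have R: "(\<integral>\<^sup>+\<omega>. indicator A (Y \<omega>) * emeasure (K (Y \<omega>)) B \<partial>P) =
      ennreal (\<integral>\<omega>\<in>(Y -` A \<inter> space P). measure (K (Y \<omega>)) B \<partial>P)"
    if [measurable]: "A \<in> sets S" "B \<in> sets T" for A B
  proof -
    have "(\<integral>\<^sup>+\<omega>. indicator A (Y \<omega>) * emeasure (K (Y \<omega>)) B \<partial>P) =
       (\<integral>\<^sup>+\<omega>. ennreal (indicat_real (Y -` A \<inter> space P) \<omega> * measure (K (Y \<omega>)) B) \<partial>P)"
      by (intro nn_integral_cong) (auto simp: em(1) indicator_def)
    also have "\<dots> = ennreal (\<integral>\<omega>. indicat_real (Y -` A \<inter> space P) \<omega> * measure (K (Y \<omega>)) B \<partial>P)"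
      using int[of B] by (intro nn_integral_eq_integral) (auto intro!: integrable_real_mult_indicator simp: mult.commute)
    finally show ?thesis by (simp add: set_lebesgue_integral_def)
  qed
  \<comment> \<open>Since both set integrals are nonnegative, their equality in
    \<open>ennreal\<close> and their equality as reals are the same statement.\<close>
  have nonneg: "0 \<le> (\<integral>\<omega>\<in>C. indicat_real E \<omega> \<partial>P)" "0 \<le> (\<integral>\<omega>\<in>C. measure (K (Y \<omega>)) B \<partial>P)" for B C E
    by (auto simp: set_lebesgue_integral_def intro!: Bochner_Integration.integral_nonneg)
  have intZ: "integrable P (indicat_real {\<omega> \<in> space P. Z \<omega> \<in> B})" if "B \<in> sets T" for B
    using that by (intro integrable_real_indicator) (auto simp: less_top[symmetric])
  show ?thesis
  proof (intro iffI ballI)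
    fix B assume ck: "cond_kernel P S Y T Z K" and B[measurable]: "B \<in> sets T"
    show "AE \<omega> in P. real_cond_exp P ?F (indicat_real {\<omega>\<in>space P. Z \<omega> \<in> B}) \<omega> = measure (K (Y \<omega>)) B"
    proof (rule real_cond_exp_charact)
      fix C assume "C \<in> sets ?F"
      then obtain A where C: "C = Y -` A \<inter> space P" and A[measurable]: "A \<in> sets S"
        using measurable_space[OF Y] by (auto simp: sets_vimage_algebra2 Pi_iff)
      have "emeasure P {\<omega>\<in>space P. Y \<omega> \<in> A \<and> Z \<omega> \<in> B}
         = (\<integral>\<^sup>+\<omega>. indicator A (Y \<omega>) * indicator B (Z \<omega>) \<partial>P)"
        by (subst nn_integral_indicator[symmetric])
           (auto intro!: nn_integral_cong simp: indicator_def simp del: nn_integral_indicator)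
      also have "\<dots> = (\<integral>\<^sup>+\<omega>. (\<integral>\<^sup>+t. indicator A (Y \<omega>) * indicator B t \<partial>K (Y \<omega>)) \<partial>P)"
        by (rule cond_kernelD[OF ck]) measurable
      also have "\<dots> = (\<integral>\<^sup>+\<omega>. indicator A (Y \<omega>) * emeasure (K (Y \<omega>)) B \<partial>P)"
        by (intro nn_integral_cong nn_integral_cmult_indicator)
           (auto simp: sets_kernel[OF K'] measurable_space[OF Y])
      finally show "(\<integral>\<omega>\<in>C. indicat_real {\<omega>\<in>space P. Z \<omega> \<in> B} \<omega> \<partial>P) = (\<integral>\<omega>\<in>C. measure (K (Y \<omega>)) B \<partial>P)"
        unfolding L[OF A B] R[OF A B] C using nonneg by simp
    qed (use int intZ B in auto)
  next
    assume ce: "\<forall>B\<in>sets T. AE \<omega> in P. real_cond_exp P ?F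
       (indicat_real {\<omega>\<in>space P. Z \<omega> \<in> B}) \<omega> = measure (K (Y \<omega>)) B"
    show "cond_kernel P S Y T Z K"
    proof (rule cond_kernelI_rectangles[OF P Y Z K])
      fix A B assume A[measurable]: "A \<in> sets S" and B[measurable]: "B \<in> sets T"
      have CF: "Y -` A \<inter> space P \<in> sets ?F"
        using measurable_space[OF Y] A by (auto simp: sets_vimage_algebra2 Pi_iff)
      have "(\<integral>\<omega>\<in>(Y -` A \<inter> space P). indicat_real {\<omega>\<in>space P. Z \<omega> \<in> B} \<omega> \<partial>P) =
        (\<integral>\<omega>\<in>(Y -` A \<inter> space P). real_cond_exp P ?F (indicat_real {\<omega>\<in>space P. Z \<omega> \<in> B}) \<omega> \<partial>P)"
        by (rule real_cond_exp_intA[OF intZ[OF B] CF])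
      also have "\<dots> = (\<integral>\<omega>\<in>(Y -` A \<inter> space P). measure (K (Y \<omega>)) B \<partial>P)"
        unfolding set_lebesgue_integral_def
        using bspec[OF ce B]
        by (intro integral_cong_AE) (auto intro!: borel_measurable_scaleR)
      finally show "emeasure P {\<omega>\<in>space P. Y \<omega> \<in> A \<and> Z \<omega> \<in> B}
        = (\<integral>\<^sup>+\<omega>. indicator A (Y \<omega>) * emeasure (K (Y \<omega>)) B \<partial>P)"
        unfolding L[OF A B] R[OF A B] by simp
    qed
  qed
qed

section \<open>Controlled processes\<close>

text \<open>The kernels are total on full histories, as the product-measure theorems require, and
  the spaces are arbitrary measurable spaces. Admissibility of actions enters only in
  \<open>decision_model\<close>.\<close>

locale controlled_process =
  fixes X :: "'x measure" and A :: "'a measure"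
    and p :: "nat \<Rightarrow> (nat \<Rightarrow> 'x \<times> 'a) \<times> 'x \<Rightarrow> 'a measure" and q :: "'x \<times> 'a \<Rightarrow> 'x measure"
  assumes p: "\<And>n. p n \<in> (\<Pi>\<^sub>M k\<in>{..<n}. X \<Otimes>\<^sub>M A) \<Otimes>\<^sub>M X \<rightarrow>\<^sub>M prob_algebra A"
    and q: "q \<in> X \<Otimes>\<^sub>M A \<rightarrow>\<^sub>M prob_algebra X"
begin

abbreviation "seqs n \<equiv> \<Pi>\<^sub>M k\<in>{..<n}. X \<Otimes>\<^sub>M A"
abbreviation "hists n \<equiv> seqs n \<Otimes>\<^sub>M X"
abbreviation hist :: "nat \<Rightarrow> (nat \<Rightarrow> 'x \<times> 'a) \<Rightarrow> (nat \<Rightarrow> 'x \<times> 'a) \<times> 'x" where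
  "hist n \<omega> \<equiv> (restrict \<omega> {..<n}, fst (\<omega> n))"

lemma p_sub[measurable]: "p n \<in> hists n \<rightarrow>\<^sub>M subprob_algebra A"
  using p by (rule measurable_prob_algebraD)

lemma q_sub[measurable]: "q \<in> X \<Otimes>\<^sub>M A \<rightarrow>\<^sub>M subprob_algebra X"
  using q by (rule measurable_prob_algebraD)

text \<open>Counterpart of \<open>is_policy_measure\<close> with disintegrations in place of
  conditional expectations and total kernels in place of partial ones.\<close>

definition law :: "'x \<Rightarrow> (nat \<Rightarrow> 'x \<times> 'a) measure \<Rightarrow> bool" where
  "law x P \<longleftrightarrow> prob_space P \<and> sets P = sets (\<Pi>\<^sub>M k\<in>UNIV. X \<Otimes>\<^sub>M A) \<and> (AE \<omega> in P. fst (\<omega> 0) = x) \<and>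
     (\<forall>n. cond_kernel P (hists n) (hist n) A (\<lambda>\<omega>. snd (\<omega> n)) (p n)) \<and>
     (\<forall>n. cond_kernel P (hists n \<Otimes>\<^sub>M A) (\<lambda>\<omega>. (hist n \<omega>, snd (\<omega> n))) X (\<lambda>\<omega>. fst (\<omega> (Suc n)))
        (\<lambda>(h, a). q (snd h, a)))"

text \<open>The recursion from (h_n, a_n, x_(n+1)) to h_(n+1): the former end state and the action
  become component \<open>n\<close> of the stored sequence.\<close>

lemma measurable_append:
  "(\<lambda>((h, a), y). ((fst h)(n := (snd h, a)), y)) \<in> (hists n \<Otimes>\<^sub>M A) \<Otimes>\<^sub>M X \<rightarrow>\<^sub>M hists (Suc n)"
proof -
  have 1: "{..<Suc n} = {..<n} \<union> {n}" by auto
  have "(\<lambda>z. (fst (fst (fst z)))(n := (snd (fst (fst z)), snd (fst z))))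
     \<in> (hists n \<Otimes>\<^sub>M A) \<Otimes>\<^sub>M X \<rightarrow>\<^sub>M seqs (Suc n)"
    by (rule measurable_fun_upd[OF 1]) measurable
  then show ?thesis by (auto simp: split_beta')
qed

lemma append_hist:
  "(\<lambda>((h, a), y). ((fst h)(n := (snd h, a)), y)) ((hist n \<omega>, snd (\<omega> n)), fst (\<omega> (Suc n))) = hist (Suc n) \<omega>"
  by (auto simp: fun_eq_iff restrict_def)

text \<open>Induction on the length of the history: integrating out the next state with
  \<open>q\<close> and the action with \<open>p n\<close> reduces an integral over h_(n+1) to one
  over h_n. Every finite cylinder depends on some h_n, and cylinders determine the measure.\<close>

lemma law_unique:
  assumes x: "x \<in> space X" and 1: "law x P" and 2: "law x P'"
  shows "P = P'"
proof -
  interpret P: prob_space P using 1 by (simp add: law_def)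
  interpret P': prob_space P' using 2 by (simp add: law_def)
  have s[measurable_cong, simp]: "sets P = sets (\<Pi>\<^sub>M k\<in>UNIV. X \<Otimes>\<^sub>M A)"
      "sets P' = sets (\<Pi>\<^sub>M k\<in>UNIV. X \<Otimes>\<^sub>M A)"
    using 1 2 by (simp_all add: law_def)
  have nn: "(\<integral>\<^sup>+\<omega>. g (hist n \<omega>) \<partial>P) = (\<integral>\<^sup>+\<omega>. g (hist n \<omega>) \<partial>P')"
    if "g \<in> borel_measurable (hists n)" for g :: "_ \<Rightarrow> ennreal" and n
    using that
  proof (induction n arbitrary: g)
    case 0
    \<comment> \<open>The history of length 0 consists of the empty sequence, represented by
      \<open>\<lambda>_. undefined\<close>, and the initial state.\<close>
    have *: "(\<integral>\<^sup>+\<omega>. g (hist 0 \<omega>) \<partial>R) = g (\<lambda>_. undefined, x)" if "law x R" for R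
    proof -
      have "(\<integral>\<^sup>+\<omega>. g (hist 0 \<omega>) \<partial>R) = (\<integral>\<^sup>+\<omega>. g (\<lambda>_. undefined, x) \<partial>R)"
        using that by (intro nn_integral_cong_AE) (auto simp: law_def restrict_def)
      then show ?thesis
        using that prob_space.emeasure_space_1[of R] by (simp add: law_def)
    qed
    show ?case by (simp only: *[OF 1] *[OF 2])
  next
    case (Suc n)
    define G where "G = (\<lambda>z. g ((\<lambda>((h, a), y). ((fst h)(n := (snd h, a)), y)) z))"
    have G[measurable]: "G \<in> borel_measurable ((hists n \<Otimes>\<^sub>M A) \<Otimes>\<^sub>M X)"
      unfolding G_def by (rule measurable_compose[OF measurable_append Suc.prems])
    \<comment> \<open>The conditional mean of \<open>g\<close> at the next history given the current
      one. Only the two kernels enter, so it is common to \<open>P\<close> and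
      \<open>P'\<close>.\<close>
    define H where "H h = (\<integral>\<^sup>+a. (\<integral>\<^sup>+y. G ((h, a), y) \<partial>q (snd h, a)) \<partial>p n h)" for h
    have G1: "(\<lambda>(h, a). \<integral>\<^sup>+y. G ((h, a), y) \<partial>q (snd h, a)) \<in> borel_measurable (hists n \<Otimes>\<^sub>M A)"
      using nn_integral_measurable_subprob_algebra2[where L="\<lambda>(h, a). q (snd h, a)" and f="\<lambda>u y. G (u, y)"
        and M="hists n \<Otimes>\<^sub>M A" and N=X]
      by (simp add: split_beta')
    have H: "H \<in> borel_measurable (hists n)"
      unfolding H_def[abs_def]
      by (rule nn_integral_measurable_subprob_algebra2[where N=A]) (use G1 in auto)
    have *: "(\<integral>\<^sup>+\<omega>. g (hist (Suc n) \<omega>) \<partial>R) = (\<integral>\<^sup>+\<omega>. H (hist n \<omega>) \<partial>R)" if R: "law x R" for R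
    proof -
      have "(\<integral>\<^sup>+\<omega>. g (hist (Suc n) \<omega>) \<partial>R) = (\<integral>\<^sup>+\<omega>. G ((hist n \<omega>, snd (\<omega> n)), fst (\<omega> (Suc n))) \<partial>R)"
        by (simp only: G_def append_hist)
      also have "\<dots> = (\<integral>\<^sup>+\<omega>. (\<integral>\<^sup>+y. G ((hist n \<omega>, snd (\<omega> n)), y) \<partial>q (fst (\<omega> n), snd (\<omega> n))) \<partial>R)"
        using R G unfolding law_def cond_kernel_def by fastforce
      also have "\<dots> = (\<integral>\<^sup>+\<omega>. H (hist n \<omega>) \<partial>R)"
        using cond_kernelD[OF _ G1, of R "hist n" "\<lambda>\<omega>. snd (\<omega> n)" "p n"] R
        unfolding law_def H_def by simp
      finally show ?thesis .
    qed
    show ?case unfolding *[OF 1] *[OF 2] by (rule Suc.IH[OF H])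
  qed
  show "P = P'"
  proof (rule measure_eqI_PiM_infinite[where I=UNIV and M="\<lambda>_. X \<Otimes>\<^sub>M A"])
    show "finite_measure P" by unfold_locales
    fix B and J :: "nat set" assume J: "finite J" "J \<subseteq> UNIV" and B: "\<And>i. i \<in> J \<Longrightarrow> B i \<in> sets (X \<Otimes>\<^sub>M A)"
    \<comment> \<open>A finite index set lies below some \<open>n\<close>, so the cylinder is an
      event of the history of length \<open>n\<close>.\<close>
    obtain n where n: "J \<subseteq> {..<n}"
      using finite_nat_set_iff_bounded[of J] J by auto
    let ?E = "{\<omega>\<in>space (seqs n). \<forall>i\<in>J. \<omega> i \<in> B i}"
    have E[measurable]: "?E \<in> sets (seqs n)"
    proof (rule sets.sets_Collect_finite_All)
      fix i assume i: "i \<in> J"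
      then have [measurable]: "B i \<in> sets (X \<Otimes>\<^sub>M A)" and [measurable]: "(\<lambda>\<omega>. \<omega> i) \<in> seqs n \<rightarrow>\<^sub>M X \<Otimes>\<^sub>M A"
        using B n by (auto intro!: measurable_component_singleton)
      show "{\<omega> \<in> space (seqs n). \<omega> i \<in> B i} \<in> sets (seqs n)" by measurable
    qed (rule J)
    have *: "emeasure R (prod_emb UNIV (\<lambda>_. X \<Otimes>\<^sub>M A) J (Pi\<^sub>E J B)) = (\<integral>\<^sup>+\<omega>. indicator ?E (fst (hist n \<omega>)) \<partial>R)"
      if [measurable_cong]: "sets R = sets (\<Pi>\<^sub>M k\<in>UNIV. X \<Otimes>\<^sub>M A)" for R
    proof -
      have "prod_emb UNIV (\<lambda>_. X \<Otimes>\<^sub>M A) J (Pi\<^sub>E J B) \<in> sets R"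
        using J B by (auto simp: that)
      then have "emeasure R (prod_emb UNIV (\<lambda>_. X \<Otimes>\<^sub>M A) J (Pi\<^sub>E J B)) =
         (\<integral>\<^sup>+\<omega>. indicator (prod_emb UNIV (\<lambda>_. X \<Otimes>\<^sub>M A) J (Pi\<^sub>E J B)) \<omega> \<partial>R)"
        by simp
      also have "\<dots> = (\<integral>\<^sup>+\<omega>. indicator ?E (fst (hist n \<omega>)) \<partial>R)"
        using n sets_eq_imp_space_eq[OF that]
        by (intro nn_integral_cong) (auto simp: indicator_def prod_emb_def space_PiM PiE_iff)
      finally show ?thesis .
    qed
    show "emeasure P (prod_emb UNIV (\<lambda>_. X \<Otimes>\<^sub>M A) J (Pi\<^sub>E J B)) = emeasure P' (prod_emb UNIV (\<lambda>_. X \<Otimes>\<^sub>M A) J (Pi\<^sub>E J B))"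
      unfolding *[OF s(1)] *[OF s(2)]
      by (rule nn[of "\<lambda>h. indicator ?E (fst h)" n]) measurable
  qed auto
qed

lemma prob_space_p: "h \<in> space (hists n) \<Longrightarrow> prob_space (p n h)"
  using measurable_space[OF p] by (simp add: space_prob_algebra)

text \<open>The Ionescu-Tulcea construction adds one coordinate at a time, and a coordinate here is
  a pair (x_n, a_n). Hence \<open>K n\<close> draws the state from \<open>\<nu> n\<close> and the
  action from \<open>p n\<close>, given the history that ends in this state. Measurability of {x}
  makes x_0 \<noteq> x an event.\<close>

lemma law_exists:
  assumes x: "x \<in> space X" and sx[measurable]: "{x} \<in> sets X"
  shows "\<exists>P. law x P"
proof -
  let ?L = "X \<Otimes>\<^sub>M A"
  \<comment> \<open>The next state depends on the past only through the last pair
    \<open>r m\<close>; at time 0 it is \<open>x\<close>.\<close>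
  define \<nu> where "\<nu> n r = (case n of 0 \<Rightarrow> return X x | Suc m \<Rightarrow> q (r m))" for n r
  define K where "K n r = \<nu> n r \<bind> (\<lambda>y. distr (p n (r, y)) ?L (\<lambda>a. (y, a)))" for n r
  have \<nu>[measurable]: "\<nu> n \<in> seqs n \<rightarrow>\<^sub>M prob_algebra X" for n
  proof (cases n)
    case 0
    then show ?thesis
      using x by (auto simp: \<nu>_def[abs_def] space_prob_algebra prob_space_return intro!: measurable_const)
  next
    case (Suc m)
    have "(\<lambda>r. q (r m)) \<in> seqs (Suc m) \<rightarrow>\<^sub>M prob_algebra X"
      by (rule measurable_compose[OF _ q]) (auto intro!: measurable_component_singleton)
    with Suc show ?thesis by (simp add: \<nu>_def[abs_def])
  qed
  have \<nu>_sub[measurable]: "\<nu> n \<in> seqs n \<rightarrow>\<^sub>M subprob_algebra X" for n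
    by (rule measurable_prob_algebraD[OF \<nu>])
  have p'[measurable]: "(\<lambda>w. distr (p n w) ?L (\<lambda>a. (snd w, a))) \<in> hists n \<rightarrow>\<^sub>M prob_algebra ?L" for n
    by (rule measurable_distr_prob_space2[OF p]) measurable
  have K[measurable]: "K n \<in> seqs n \<rightarrow>\<^sub>M prob_algebra ?L" for n
    unfolding K_def[abs_def]
    by (rule measurable_bind_prob_space2[OF \<nu>]) (use p'[of n] in \<open>simp add: split_beta'\<close>)
  have K_sub[measurable]: "K n \<in> seqs n \<rightarrow>\<^sub>M subprob_algebra ?L" for n
    by (rule measurable_prob_algebraD[OF K])
  have nn_K: "(\<integral>\<^sup>+z. g z \<partial>K n r) = (\<integral>\<^sup>+y. (\<integral>\<^sup>+a. g (y, a) \<partial>p n (r, y)) \<partial>\<nu> n r)"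
    if r: "r \<in> space (seqs n)" and g[measurable]: "g \<in> borel_measurable ?L" for g :: "_ \<Rightarrow> ennreal" and n r
  proof -
    have sp: "space (\<nu> n r) = space X" "sets (\<nu> n r) = sets X"
      using subprob_measurableD[OF \<nu>_sub r] by auto
    have "(\<lambda>y. distr (p n (r, y)) ?L (\<lambda>a. (y, a))) \<in> X \<rightarrow>\<^sub>M subprob_algebra ?L"
      using measurable_compose[OF measurable_Pair1'[OF r] measurable_prob_algebraD[OF p'[of n]]] by simp
    then have "(\<integral>\<^sup>+z. g z \<partial>K n r) = (\<integral>\<^sup>+y. (\<integral>\<^sup>+z. g z \<partial>distr (p n (r, y)) ?L (\<lambda>a. (y, a))) \<partial>\<nu> n r)"
      unfolding K_def by (intro nn_integral_bind[OF g]) (simp add: measurable_cong_sets[OF sp(2) refl])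
    also have "\<dots> = (\<integral>\<^sup>+y. (\<integral>\<^sup>+a. g (y, a) \<partial>p n (r, y)) \<partial>\<nu> n r)"
    proof (rule nn_integral_cong)
      fix y assume "y \<in> space (\<nu> n r)"
      then have "(r, y) \<in> space (hists n)" "y \<in> space X" using r sp by (auto simp: space_pair_measure)
      then have "(\<lambda>a. (y, a)) \<in> p n (r, y) \<rightarrow>\<^sub>M ?L"
        by (subst subprob_measurableD(3)[OF p_sub]) auto
      then show "(\<integral>\<^sup>+z. g z \<partial>distr (p n (r, y)) ?L (\<lambda>a. (y, a))) = (\<integral>\<^sup>+a. g (y, a) \<partial>p n (r, y))"
        by (rule nn_integral_distr) (use g in simp)
    qed
    finally show ?thesis .
  qed
  interpret IT: Ionescu_Tulcea K "\<lambda>_. ?L"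
  proof (rule Ionescu_Tulcea.intro)
    show "K i \<in> (\<Pi>\<^sub>M _\<in>{0..<i}. ?L) \<rightarrow>\<^sub>M subprob_algebra ?L" for i
      using K_sub by (simp add: lessThan_atLeast0)
    show "prob_space (K i r)" if "r \<in> space (\<Pi>\<^sub>M _\<in>{0..<i}. ?L)" for i r
      using measurable_space[OF K, of r i] that by (simp add: lessThan_atLeast0 space_prob_algebra)
  qed
  define P where "P = IT.PF.lim"
  have sets_P[measurable_cong]: "sets P = sets (\<Pi>\<^sub>M k\<in>UNIV. ?L)"
    by (simp add: P_def)
  have space_P: "space P = space (\<Pi>\<^sub>M k\<in>UNIV. ?L)"
    by (rule sets_eq_imp_space_eq[OF sets_P])
  \<comment> \<open>Total mass is read off from the marginal on the empty index set.\<close>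
  interpret prob_space P
  proof (rule prob_space_distrD)
    show "(\<lambda>\<omega>. restrict \<omega> {}) \<in> P \<rightarrow>\<^sub>M (\<Pi>\<^sub>M k\<in>({}::nat set). ?L)"
      by (rule measurable_restrict) simp
    show "prob_space (distr P (\<Pi>\<^sub>M k\<in>{}. ?L) (\<lambda>\<omega>. restrict \<omega> {}))"
      unfolding P_def IT.distr_lim[OF finite.emptyI] by (rule IT.PF.prob_space_P) simp_all
  qed
  \<comment> \<open>Given the first \<open>n\<close> pairs, coordinate \<open>n\<close> has law
    \<open>K n\<close>. Both disintegrations required by \<open>law\<close> are derived from this
    identity.\<close>
  have step: "(\<integral>\<^sup>+\<omega>. g (restrict \<omega> {..<n}) (\<omega> n) \<partial>P) =
      (\<integral>\<^sup>+\<omega>. (\<integral>\<^sup>+y. (\<integral>\<^sup>+a. g (restrict \<omega> {..<n}) (y, a) \<partial>p n (restrict \<omega> {..<n}, y)) \<partial>\<nu> n (restrict \<omega> {..<n})) \<partial>P)"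
    if "(\<lambda>(r, z). g r z) \<in> borel_measurable (seqs n \<Otimes>\<^sub>M ?L)" for g :: "_ \<Rightarrow> _ \<Rightarrow> ennreal" and n
  proof -
    have g[measurable]: "(\<lambda>(r, z). g r z) \<in> borel_measurable ((\<Pi>\<^sub>M k\<in>{0..<n}. ?L) \<Otimes>\<^sub>M ?L)"
      using that by (simp add: lessThan_atLeast0)
    \<comment> \<open>The projective family consists of the finite-horizon measures
      \<open>IT.C\<close> restricted to an index set. For an initial segment the horizon
      \<open>up_to\<close> is its length, so the restriction changes nothing.\<close>
    have CI: "IT.CI {0..<m} = IT.C 0 m (\<lambda>_. undefined)" for m
    proof -
      have "IT.up_to {0..<m} = m"
        using IT.up_to_iff[of "{0..<m}" "IT.up_to {0..<m}"] IT.up_to_iff[of "{0..<m}" m]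
        by (auto intro!: antisym)
      then have "IT.CI {0..<m} = distr (IT.C 0 m (\<lambda>_. undefined)) (\<Pi>\<^sub>M k\<in>{0..<0+m}. ?L) (\<lambda>f. restrict f {0..<0+m})"
        by (simp add: IT.CI_def)
      also have "\<dots> = IT.C 0 m (\<lambda>_. undefined)"
        by (rule IT.distr_C[symmetric]) auto
      finally show ?thesis .
    qed
    have u: "(\<lambda>_. undefined) \<in> space (\<Pi>\<^sub>M k\<in>{0..<0::nat}. ?L)" by (simp add: space_PiM)
    have sC: "sets (IT.C 0 m (\<lambda>_. undefined)) = sets (\<Pi>\<^sub>M k\<in>{0..<m}. ?L)"
        "space (IT.C 0 m (\<lambda>_. undefined)) = space (\<Pi>\<^sub>M k\<in>{0..<m}. ?L)" for m
      using IT.sets_C[OF u, of m] IT.space_C[OF u, of m] by auto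
    have nn_C: "(\<integral>\<^sup>+\<omega>. h (restrict \<omega> {0..<m}) \<partial>P) = (\<integral>\<^sup>+r. h r \<partial>IT.C 0 m (\<lambda>_. undefined))"
      if [measurable]: "h \<in> borel_measurable (\<Pi>\<^sub>M k\<in>{0..<m}. ?L)" for h :: "_ \<Rightarrow> ennreal" and m
      unfolding CI[symmetric] IT.distr_lim[OF finite_atLeastLessThan, symmetric] P_def[symmetric]
      by (subst nn_integral_distr) (auto intro!: measurable_restrict_subset simp: measurable_cong_sets[OF sets_P refl])
    have g1[measurable]: "(\<lambda>r. g (restrict r {0..<n}) (r n)) \<in> borel_measurable (\<Pi>\<^sub>M k\<in>{0..<Suc n}. ?L)"
    proof -
      have "(\<lambda>r. (restrict r {0..<n}, r n)) \<in> (\<Pi>\<^sub>M k\<in>{0..<Suc n}. ?L) \<rightarrow>\<^sub>M (\<Pi>\<^sub>M k\<in>{0..<n}. ?L) \<Otimes>\<^sub>M ?L"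
        by (intro measurable_Pair measurable_restrict_subset measurable_component_singleton) auto
      from measurable_compose[OF this g] show ?thesis by simp
    qed
    have "(\<integral>\<^sup>+\<omega>. g (restrict \<omega> {0..<n}) (\<omega> n) \<partial>P) =
        (\<integral>\<^sup>+\<omega>. (\<lambda>r. g (restrict r {0..<n}) (r n)) (restrict \<omega> {0..<Suc n}) \<partial>P)"
      by (intro nn_integral_cong) (auto simp: restrict_def fun_eq_iff intro!: arg_cong2[where f=g])
    also have "\<dots> = (\<integral>\<^sup>+r. g (restrict r {0..<n}) (r n) \<partial>IT.C 0 (Suc n) (\<lambda>_. undefined))"
      by (rule nn_C[OF g1])
    also have "\<dots> = (\<integral>\<^sup>+r. (\<integral>\<^sup>+r'. g (restrict r' {0..<n}) (r' n) \<partial>IT.eP n r) \<partial>IT.C 0 n (\<lambda>_. undefined))"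
      using IT.measurable_eP[of n]
      by (simp add: nn_integral_bind[OF g1] measurable_cong_sets[OF sC(1) refl])
    also have "\<dots> = (\<integral>\<^sup>+r. (\<integral>\<^sup>+z. g r z \<partial>K n r) \<partial>IT.C 0 n (\<lambda>_. undefined))"
    proof (rule nn_integral_cong)
      fix r assume "r \<in> space (IT.C 0 n (\<lambda>_. undefined))"
      then have r: "r \<in> space (\<Pi>\<^sub>M k\<in>{0..<n}. ?L)" by (simp add: sC)
      then have "restrict (r(n := z)) {0..<n} = r" for z
        by (auto simp: space_PiM PiE_iff extensional_def fun_eq_iff)
      then show "(\<integral>\<^sup>+r'. g (restrict r' {0..<n}) (r' n) \<partial>IT.eP n r) = (\<integral>\<^sup>+z. g r z \<partial>K n r)"
        by (simp add: IT.nn_integral_eP[OF r g1])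
    qed
    also have "\<dots> = (\<integral>\<^sup>+\<omega>. (\<integral>\<^sup>+z. g (restrict \<omega> {0..<n}) z \<partial>K n (restrict \<omega> {0..<n})) \<partial>P)"
      by (rule nn_C[symmetric], rule nn_integral_measurable_subprob_algebra2[OF g])
         (use K_sub[of n] in \<open>simp add: lessThan_atLeast0\<close>)
    also have "\<dots> = (\<integral>\<^sup>+\<omega>. (\<integral>\<^sup>+y. (\<integral>\<^sup>+a. g (restrict \<omega> {0..<n}) (y, a) \<partial>p n (restrict \<omega> {0..<n}, y)) \<partial>\<nu> n (restrict \<omega> {0..<n})) \<partial>P)"
    proof (rule nn_integral_cong)
      fix \<omega> assume "\<omega> \<in> space P"
      then have r: "restrict \<omega> {0..<n} \<in> space (\<Pi>\<^sub>M k\<in>{0..<n}. ?L)" by (auto simp: space_P space_PiM PiE_iff)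
      have "g (restrict \<omega> {0..<n}) \<in> borel_measurable ?L"
        using measurable_compose[OF measurable_Pair1'[OF r] g] by simp
      with r show "(\<integral>\<^sup>+z. g (restrict \<omega> {0..<n}) z \<partial>K n (restrict \<omega> {0..<n})) =
        (\<integral>\<^sup>+y. (\<integral>\<^sup>+a. g (restrict \<omega> {0..<n}) (y, a) \<partial>p n (restrict \<omega> {0..<n}, y)) \<partial>\<nu> n (restrict \<omega> {0..<n}))"
        using nn_K[of "restrict \<omega> {0..<n}" n] by (simp add: lessThan_atLeast0)
    qed
    finally show ?thesis by (simp add: lessThan_atLeast0)
  qed
  have r_in: "restrict \<omega> {..<n} \<in> space (seqs n)" "\<omega> n \<in> space ?L" if "\<omega> \<in> space P" for \<omega> n
    using that by (auto simp: space_P space_PiM PiE_iff)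
  have prob_\<nu>: "prob_space (\<nu> n r)" "space (\<nu> n r) = space X" if "r \<in> space (seqs n)" for n r
    using measurable_space[OF \<nu> that] sets_eq_imp_space_eq[of "\<nu> n r" X] by (simp_all add: space_prob_algebra)
  have em_p: "emeasure (p n (restrict \<omega> {..<n}, y)) (space (p n (restrict \<omega> {..<n}, y))) = 1"
    if "\<omega> \<in> space P" "y \<in> space X" for n \<omega> y
    using prob_space_p[of "(restrict \<omega> {..<n}, y)" n] that r_in(1)[OF that(1)]
    by (simp add: space_pair_measure prob_space.emeasure_space_1)
  have "law x P"
    unfolding law_def
  proof (intro conjI allI)
    show "prob_space P" by unfold_locales
    show "sets P = sets (\<Pi>\<^sub>M k\<in>UNIV. ?L)" by (rule sets_P)
    have "(\<integral>\<^sup>+\<omega>. indicator (space X - {x}) (fst (\<omega> 0)) \<partial>P) =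
      (\<integral>\<^sup>+\<omega>. (\<integral>\<^sup>+y. (\<integral>\<^sup>+a. indicator (space X - {x}) (fst (y, a)) \<partial>p 0 (restrict \<omega> {..<0}, y))
         \<partial>\<nu> 0 (restrict \<omega> {..<0})) \<partial>P)"
      by (rule step[of "\<lambda>r z. indicator (space X - {x}) (fst z)" 0]) measurable
    also have "\<dots> = (\<integral>\<^sup>+\<omega>. (\<integral>\<^sup>+y. indicator (space X - {x}) y \<partial>\<nu> 0 (restrict \<omega> {..<0})) \<partial>P)"
      by (intro nn_integral_cong) (simp add: em_p prob_\<nu>[OF r_in(1)] del: lessThan_0)
    also have "\<dots> = 0"
      using x by (simp add: \<nu>_def nn_integral_return)
    finally have "AE \<omega> in P. fst (\<omega> 0) \<notin> space X - {x}"
      by (subst (asm) nn_integral_0_iff_AE) (auto elim!: eventually_mono simp: indicator_def)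
    moreover have "AE \<omega> in P. fst (\<omega> 0) \<in> space X"
      using r_in(2)[of _ 0] by (intro AE_I2) (simp add: space_pair_measure mem_Times_iff)
    ultimately show "AE \<omega> in P. fst (\<omega> 0) = x"
      by eventually_elim auto
  next
    fix n
    show "cond_kernel P (hists n) (hist n) A (\<lambda>\<omega>. snd (\<omega> n)) (p n)"
      unfolding cond_kernel_def
    proof (intro allI impI)
      fix g :: "_ \<Rightarrow> ennreal" assume g[measurable]: "g \<in> borel_measurable (hists n \<Otimes>\<^sub>M A)"
      define G where "G h = (\<integral>\<^sup>+a. g (h, a) \<partial>p n h)" for h
      have G[measurable]: "G \<in> borel_measurable (hists n)"
        unfolding G_def[abs_def] by (rule nn_integral_measurable_subprob_algebra2[where N=A]) auto
      have "(\<integral>\<^sup>+\<omega>. g (hist n \<omega>, snd (\<omega> n)) \<partial>P) =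
        (\<integral>\<^sup>+\<omega>. (\<integral>\<^sup>+y. (\<integral>\<^sup>+a. g ((restrict \<omega> {..<n}, fst (y, a)), snd (y, a)) \<partial>p n (restrict \<omega> {..<n}, y)) \<partial>\<nu> n (restrict \<omega> {..<n})) \<partial>P)"
        by (rule step[of "\<lambda>r z. g ((r, fst z), snd z)" n]) measurable
      also have "\<dots> = (\<integral>\<^sup>+\<omega>. (\<integral>\<^sup>+y. G (restrict \<omega> {..<n}, y) \<partial>\<nu> n (restrict \<omega> {..<n})) \<partial>P)"
        by (simp add: G_def)
      \<comment> \<open>The integral over the action is reinserted with an integrand constant in
        \<open>a\<close>. It has mass one, and the expression takes the form to which
        \<open>step\<close> applies backwards.\<close>
      also have "\<dots> = (\<integral>\<^sup>+\<omega>. (\<integral>\<^sup>+y. (\<integral>\<^sup>+a. G (restrict \<omega> {..<n}, fst (y, a)) \<partial>p n (restrict \<omega> {..<n}, y)) \<partial>\<nu> n (restrict \<omega> {..<n})) \<partial>P)"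
        by (intro nn_integral_cong) (simp add: em_p prob_\<nu>[OF r_in(1)])
      also have "\<dots> = (\<integral>\<^sup>+\<omega>. G (hist n \<omega>) \<partial>P)"
        by (rule step[of "\<lambda>r z. G (r, fst z)" n, symmetric]) measurable
      finally show "(\<integral>\<^sup>+\<omega>. g (hist n \<omega>, snd (\<omega> n)) \<partial>P) = (\<integral>\<^sup>+\<omega>. (\<integral>\<^sup>+a. g (hist n \<omega>, a) \<partial>p n (hist n \<omega>)) \<partial>P)"
        by (simp add: G_def)
    qed
    show "cond_kernel P (hists n \<Otimes>\<^sub>M A) (\<lambda>\<omega>. (hist n \<omega>, snd (\<omega> n))) X (\<lambda>\<omega>. fst (\<omega> (Suc n)))
        (\<lambda>(h, a). q (snd h, a))"
      unfolding cond_kernel_def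
    proof (intro allI impI)
      fix g :: "_ \<Rightarrow> ennreal" assume g[measurable]: "g \<in> borel_measurable ((hists n \<Otimes>\<^sub>M A) \<Otimes>\<^sub>M X)"
      \<comment> \<open>The first n+1 pairs determine (h_n, a_n), so conditioning on them at time
        \<open>Suc n\<close> yields the transition law; the action drawn at time
        \<open>Suc n\<close> integrates out.\<close>
      let ?\<phi> = "\<lambda>r. ((restrict r {..<n}, fst (r n)), snd (r n))"
      have [measurable]: "(\<lambda>r. r n) \<in> seqs (Suc n) \<rightarrow>\<^sub>M ?L" "(\<lambda>r. restrict r {..<n}) \<in> seqs (Suc n) \<rightarrow>\<^sub>M seqs n"
        by (auto intro!: measurable_component_singleton measurable_restrict_subset)
      have \<phi>: "?\<phi> \<in> seqs (Suc n) \<rightarrow>\<^sub>M hists n \<Otimes>\<^sub>M A"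
        by measurable
      have \<phi>_eq: "?\<phi> (restrict \<omega> {..<Suc n}) = (hist n \<omega>, snd (\<omega> n))" for \<omega> :: "nat \<Rightarrow> 'x \<times> 'a"
        by (auto simp: restrict_def fun_eq_iff)
      have m: "(\<lambda>(r, z). g (?\<phi> r, fst z)) \<in> borel_measurable (seqs (Suc n) \<Otimes>\<^sub>M ?L)"
        using \<phi> by measurable
      have "(\<integral>\<^sup>+\<omega>. g ((hist n \<omega>, snd (\<omega> n)), fst (\<omega> (Suc n))) \<partial>P) =
          (\<integral>\<^sup>+\<omega>. g (?\<phi> (restrict \<omega> {..<Suc n}), fst (\<omega> (Suc n))) \<partial>P)"
        unfolding \<phi>_eq ..
      also have "\<dots> = (\<integral>\<^sup>+\<omega>. (\<integral>\<^sup>+y. (\<integral>\<^sup>+a. g (?\<phi> (restrict \<omega> {..<Suc n}), fst (y, a))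
          \<partial>p (Suc n) (restrict \<omega> {..<Suc n}, y)) \<partial>\<nu> (Suc n) (restrict \<omega> {..<Suc n})) \<partial>P)"
        by (rule step[of "\<lambda>r z. g (?\<phi> r, fst z)" "Suc n", OF m])
      also have "\<dots> = (\<integral>\<^sup>+\<omega>. (\<integral>\<^sup>+y. g (?\<phi> (restrict \<omega> {..<Suc n}), y) \<partial>\<nu> (Suc n) (restrict \<omega> {..<Suc n})) \<partial>P)"
        by (intro nn_integral_cong) (simp add: em_p prob_\<nu>[OF r_in(1)])
      also have "\<dots> = (\<integral>\<^sup>+\<omega>. (\<integral>\<^sup>+y. g ((hist n \<omega>, snd (\<omega> n)), y) \<partial>q (\<omega> n)) \<partial>P)"
        unfolding \<phi>_eq by (simp add: \<nu>_def)
      finally show "(\<integral>\<^sup>+\<omega>. g ((hist n \<omega>, snd (\<omega> n)), fst (\<omega> (Suc n))) \<partial>P) =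
        (\<integral>\<^sup>+\<omega>. (\<integral>\<^sup>+y. g ((hist n \<omega>, snd (\<omega> n)), y) \<partial>(case (hist n \<omega>, snd (\<omega> n)) of (h, a) \<Rightarrow> q (snd h, a))) \<partial>P)"
        by simp
    qed
  qed
  then show ?thesis ..
qed

end

section \<open>The process of a policy\<close>

lemma AE_notin_if_nn_integral_eq_0:
  assumes "(\<integral>\<^sup>+\<omega>. indicator B (Z \<omega>) \<partial>P) = 0" and [measurable]: "Z \<in> P \<rightarrow>\<^sub>M M" "B \<in> sets M"
  shows "AE \<omega> in P. Z \<omega> \<notin> B"
proof -
  have "AE \<omega> in P. indicator B (Z \<omega>) = (0::ennreal)"
    using assms(1) by (subst (asm) nn_integral_0_iff_AE) auto
  then show ?thesis by eventually_elim (simp add: indicator_eq_0_iff)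
qed

text \<open>The selector \<open>f0\<close> witnesses that admissible sets are nonempty and that
  policies exist, and it supplies a measurable default action on histories where a policy is not
  specified.\<close>

locale decision_model =
  fixes D :: "('x::polish_space, 'a::polish_space) mdm" and f0 :: "'x \<Rightarrow> 'a"
  assumes model: "markov_decision_model D" and f0: "f0 \<in> selectors D"
begin

abbreviation "X \<equiv> states D"
abbreviation "A \<equiv> actions D"
abbreviation "\<X> \<equiv> borel_on (states D)"
abbreviation "\<A> \<equiv> borel_on (actions D)"
abbreviation "G \<equiv> graph D"

lemma X_sets: "X \<in> sets borel"
  and G_sets[measurable]: "G \<in> sets (\<X> \<Otimes>\<^sub>M \<A>)"
  and tr: "tr_kernel D \<in> borel_on G \<rightarrow>\<^sub>M prob_algebra \<X>"
  and cost: "cost D \<in> borel_measurable (borel_on G)"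
  and discount: "0 < discount D" "discount D < 1"
  using model by (auto simp: markov_decision_model_def)

lemma space_X: "space \<X> = X" and space_A: "space \<A> = A"
  by (simp_all add: space_restrict_space)

lemma GI: "x \<in> X \<Longrightarrow> a \<in> adm D x \<Longrightarrow> (x, a) \<in> G"
  by (simp add: graph_def)

lemma G_D:
  assumes z: "z \<in> G"
  shows "fst z \<in> X" and "snd z \<in> adm D (fst z)" and "snd z \<in> A"
proof -
  show 1: "fst z \<in> X" "snd z \<in> adm D (fst z)" using z by (auto simp: graph_def)
  have "\<forall>x\<in>X. adm D x \<subseteq> A" using model by (simp add: markov_decision_model_def)
  then show "snd z \<in> A" using 1 by blast
qed

lemma adm_nonempty: "x \<in> X \<Longrightarrow> adm D x \<noteq> {}"
  using f0 by (auto simp: selectors_def)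

lemma selectorsD: "f \<in> selectors D \<Longrightarrow> f \<in> \<X> \<rightarrow>\<^sub>M \<A>"
  "f \<in> selectors D \<Longrightarrow> x \<in> X \<Longrightarrow> f x \<in> adm D x"
  "f \<in> selectors D \<Longrightarrow> x \<in> X \<Longrightarrow> (x, f x) \<in> G"
  by (auto simp: selectors_def graph_def)

lemma adm_sets: "x \<in> X \<Longrightarrow> adm D x \<in> sets \<A>"
  using sets_Pair1[OF G_sets, of x] by (simp add: graph_def vimage_def)

lemma singleton_sets: "x \<in> X \<Longrightarrow> {x} \<in> sets \<X>"
  using X_sets by (auto simp: sets_restrict_space_iff)

section \<open>Extension of kernels beyond the graph\<close>

text \<open>\<open>borel_on G\<close> carries the Borel sets of the product topology, trajectories
  carry the product \<sigma>-algebra. Second countability of Polish spaces makes the identity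
  measurable between them.\<close>

lemma measurable_id_borel: "(\<lambda>z. z) \<in> \<X> \<Otimes>\<^sub>M \<A> \<rightarrow>\<^sub>M borel"
proof -
  have "(\<lambda>z. (fst z, snd z)) \<in> \<X> \<Otimes>\<^sub>M \<A> \<rightarrow>\<^sub>M borel"
    by (intro borel_measurable_Pair measurable_compose[OF measurable_fst] measurable_compose[OF measurable_snd]
        measurable_restrict_space1 measurable_ident_sets refl)
  then show ?thesis by simp
qed

text \<open>Two measurable pieces glue along the measurable graph; in this way the transition kernel
  and real functions on the graph are continued to the full product.\<close>

lemma measurable_on_graph:
  assumes f: "f \<in> borel_on G \<rightarrow>\<^sub>M N" and g: "g \<in> \<X> \<Otimes>\<^sub>M \<A> \<rightarrow>\<^sub>M N"
  shows "(\<lambda>z. if z \<in> G then f z else g z) \<in> \<X> \<Otimes>\<^sub>M \<A> \<rightarrow>\<^sub>M N"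
proof (subst measurable_If_restrict_space_iff)
  have "(\<lambda>z. z) \<in> restrict_space (\<X> \<Otimes>\<^sub>M \<A>) G \<rightarrow>\<^sub>M borel_on G"
    by (intro measurable_restrict_space2 measurable_restrict_space1 measurable_id_borel)
       (auto simp: space_restrict_space)
  from measurable_compose[OF this f] g
  show "f \<in> restrict_space (\<X> \<Otimes>\<^sub>M \<A>) {z. z \<in> G} \<rightarrow>\<^sub>M N \<and> g \<in> restrict_space (\<X> \<Otimes>\<^sub>M \<A>) {z. z \<notin> G} \<rightarrow>\<^sub>M N"
    by (auto intro: measurable_restrict_space1)
qed simp

text \<open>Off the graph the process stays where it is, a default that depends measurably on the
  pair.\<close>

definition tr_ext :: "'x \<times> 'a \<Rightarrow> 'x measure" where
  "tr_ext z = (if z \<in> G then tr_kernel D z else return \<X> (fst z))"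

lemma tr_ext: "tr_ext \<in> \<X> \<Otimes>\<^sub>M \<A> \<rightarrow>\<^sub>M prob_algebra \<X>"
  unfolding tr_ext_def[abs_def]
  by (rule measurable_on_graph[OF tr]) measurable

abbreviation "H n \<equiv> space (hist_space D n)"

lemma space_hist: "H n = ({..<n} \<rightarrow>\<^sub>E G) \<times> X"
  by (simp add: hist_space_def space_pair_measure space_PiM space_restrict_space)

lemma full_hist_space_eq: "full_hist_space D n = (\<Pi>\<^sub>M k\<in>{..<n}. \<X> \<Otimes>\<^sub>M \<A>) \<Otimes>\<^sub>M \<X>"
  by (simp add: full_hist_space_def state_action_space_def)

lemma H_sets[measurable]: "H n \<in> sets ((\<Pi>\<^sub>M k\<in>{..<n}. \<X> \<Otimes>\<^sub>M \<A>) \<Otimes>\<^sub>M \<X>)"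
  unfolding space_hist using sets.top[of \<X>] by (intro pair_measureI sets_PiM_I_finite) (auto simp: space_X)

definition policy_ext :: "('x, 'a) policy \<Rightarrow> ('x, 'a) policy" where
  "policy_ext \<pi> n h = (if h \<in> H n then \<pi> n h else return \<A> (f0 (snd h)))"

lemma policy_ext:
  assumes \<pi>: "\<pi> \<in> policies D"
  shows "policy_ext \<pi> n \<in> (\<Pi>\<^sub>M k\<in>{..<n}. \<X> \<Otimes>\<^sub>M \<A>) \<Otimes>\<^sub>M \<X> \<rightarrow>\<^sub>M prob_algebra \<A>" (is "_ \<in> ?F \<rightarrow>\<^sub>M _")
  unfolding policy_ext_def[abs_def]
proof (subst measurable_If_restrict_space_iff)
  let ?R = "restrict_space ?F (H n)"
  have f0'[measurable]: "f0 \<in> \<X> \<rightarrow>\<^sub>M \<A>" using f0 by (rule selectorsD)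
  \<comment> \<open>\<open>hist_space\<close> is built from \<open>borel_on G\<close>, the
    surrounding space from \<open>\<X>\<close> and \<open>\<A>\<close>. Coordinates are moved from
    one structure to the other before \<pi> can be composed with them.\<close>
  have comp: "(\<lambda>h. fst h i) \<in> ?R \<rightarrow>\<^sub>M borel_on G" if "i < n" for i
  proof (rule measurable_restrict_space2)
    show "(\<lambda>h. fst h i) \<in> space ?R \<rightarrow> G"
    proof
      fix h assume "h \<in> space ?R"
      then have "h \<in> H n" by (simp add: space_restrict_space)
      then have "fst h \<in> {..<n} \<rightarrow>\<^sub>E G" unfolding space_hist by (rule mem_Times_iff[THEN iffD1, THEN conjunct1])
      then show "fst h i \<in> G" by (rule PiE_mem) (use that in simp)
    qed
    have f: "fst \<in> ?F \<rightarrow>\<^sub>M (\<Pi>\<^sub>M k\<in>{..<n}. \<X> \<Otimes>\<^sub>M \<A>)" by (rule measurable_fst)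
    have c: "(\<lambda>r. r i) \<in> (\<Pi>\<^sub>M k\<in>{..<n}. \<X> \<Otimes>\<^sub>M \<A>) \<rightarrow>\<^sub>M \<X> \<Otimes>\<^sub>M \<A>"
      by (rule measurable_component_singleton) (use that in simp)
    have "(\<lambda>h. fst h i) \<in> ?F \<rightarrow>\<^sub>M borel"
      by (rule measurable_compose[OF measurable_compose[OF f c] measurable_id_borel])
    then show "(\<lambda>h. fst h i) \<in> ?R \<rightarrow>\<^sub>M borel" by (rule measurable_restrict_space1)
  qed
  have "(\<lambda>h i. fst h i) \<in> ?R \<rightarrow>\<^sub>M (\<Pi>\<^sub>M k\<in>{..<n}. borel_on G)"
    by (rule measurable_PiM_single') (use comp in \<open>auto simp: space_restrict_space space_hist PiE_iff extensional_def\<close>)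
  moreover have "snd \<in> ?R \<rightarrow>\<^sub>M \<X>" by (intro measurable_restrict_space1 measurable_snd)
  ultimately have "(\<lambda>h. (fst h, snd h)) \<in> ?R \<rightarrow>\<^sub>M hist_space D n"
    unfolding hist_space_def by (intro measurable_Pair) simp_all
  moreover have "\<pi> n \<in> hist_space D n \<rightarrow>\<^sub>M prob_algebra \<A>" using \<pi> by (simp add: policies_def)
  ultimately have "\<pi> n \<in> ?R \<rightarrow>\<^sub>M prob_algebra \<A>"
    using measurable_compose by fastforce
  moreover have "(\<lambda>h. return \<A> (f0 (snd h))) \<in> ?F \<rightarrow>\<^sub>M prob_algebra \<A>" by measurable
  ultimately show "\<pi> n \<in> restrict_space ?F {h. h \<in> H n} \<rightarrow>\<^sub>M prob_algebra \<A> \<and>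
      (\<lambda>h. return \<A> (f0 (snd h))) \<in> restrict_space ?F {h. h \<notin> H n} \<rightarrow>\<^sub>M prob_algebra \<A>"
    by (auto intro: measurable_restrict_space1)
qed simp

lemma controlled_process: "\<pi> \<in> policies D \<Longrightarrow> controlled_process \<X> \<A> (policy_ext \<pi>) tr_ext"
  by (rule controlled_process.intro[OF policy_ext tr_ext])

text \<open>Strong induction on time: when all earlier pairs lie in \<open>G\<close>, the history
  lies in \<open>H n\<close>, where the extended policy is \<pi> and charges only admissible
  actions. The kernel identity is assumed merely under membership of the history in
  \<open>H n\<close> because, for a measure given by \<open>is_policy_measure\<close>, it is
  available only then.\<close>

lemma AE_graph:
  assumes \<pi>: "\<pi> \<in> policies D" and P: "prob_space P" "sets P = sets (\<Pi>\<^sub>M k\<in>UNIV. \<X> \<Otimes>\<^sub>M \<A>)"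
    and ck: "\<And>n. AE \<omega> in P. (restrict \<omega> {..<n}, fst (\<omega> n)) \<in> H n \<Longrightarrow>
      cond_kernel P ((\<Pi>\<^sub>M k\<in>{..<n}. \<X> \<Otimes>\<^sub>M \<A>) \<Otimes>\<^sub>M \<X>) (\<lambda>\<omega>. (restrict \<omega> {..<n}, fst (\<omega> n))) \<A>
        (\<lambda>\<omega>. snd (\<omega> n)) (policy_ext \<pi> n)"
  shows "AE \<omega> in P. \<forall>k. \<omega> k \<in> G" and "AE \<omega> in P. \<forall>n. (restrict \<omega> {..<n}, fst (\<omega> n)) \<in> H n"
proof -
  have sp: "space P = space (\<Pi>\<^sub>M k\<in>UNIV. \<X> \<Otimes>\<^sub>M \<A>)" by (rule sets_eq_imp_space_eq[OF P(2)])
  note P(2)[measurable_cong]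
  have H: "(restrict \<omega> {..<n}, fst (\<omega> n)) \<in> H n" if "\<omega> \<in> space P" "\<forall>k<n. \<omega> k \<in> G" for \<omega> n
  proof -
    have "\<omega> n \<in> space (\<X> \<Otimes>\<^sub>M \<A>)" using that by (auto simp: sp space_PiM)
    then have "fst (\<omega> n) \<in> X" by (simp add: space_pair_measure mem_Times_iff space_X)
    then show ?thesis using that by (auto simp: space_hist)
  qed
  have "AE \<omega> in P. \<omega> n \<in> G" for n
  proof (induction n rule: less_induct)
    case (less n)
    have "AE \<omega> in P. \<forall>k\<in>{..<n}. \<omega> k \<in> G"
      using less by (intro AE_finite_allI) auto
    then have Hn: "AE \<omega> in P. (restrict \<omega> {..<n}, fst (\<omega> n)) \<in> H n"
      using AE_space by eventually_elim (auto intro: H)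
    let ?h = "\<lambda>\<omega>. (restrict \<omega> {..<n}, fst (\<omega> n))"
    have "(\<integral>\<^sup>+\<omega>. indicator (space (\<X> \<Otimes>\<^sub>M \<A>) - G) (snd (?h \<omega>), snd (\<omega> n)) \<partial>P) =
       (\<integral>\<^sup>+\<omega>. (\<integral>\<^sup>+a. indicator (space (\<X> \<Otimes>\<^sub>M \<A>) - G) (snd (?h \<omega>), a) \<partial>policy_ext \<pi> n (?h \<omega>)) \<partial>P)"
      by (rule cond_kernelD[OF ck[OF Hn], of "\<lambda>h a. indicator (space (\<X> \<Otimes>\<^sub>M \<A>) - G) (snd h, a)"]) measurable
    also have "\<dots> = (\<integral>\<^sup>+\<omega>. 0 \<partial>P)"
    proof (rule nn_integral_cong_AE, use Hn in eventually_elim)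
      fix \<omega> assume h: "?h \<omega> \<in> H n"
      then have x: "fst (\<omega> n) \<in> X" by (auto simp: space_hist)
      have \<pi>n: "\<pi> n (?h \<omega>) \<in> space (prob_algebra \<A>)" "measure (\<pi> n (?h \<omega>)) (adm D (fst (\<omega> n))) = 1"
        using \<pi> measurable_space[OF _ h, of "\<pi> n" "prob_algebra \<A>"] bspec[OF _ h, of "\<lambda>h. measure (\<pi> n h) (adm D (snd h)) = 1"]
        by (simp_all add: policies_def)
      then interpret p: prob_space "\<pi> n (?h \<omega>)" by (simp add: space_prob_algebra)
      have "AE a in \<pi> n (?h \<omega>). a \<in> adm D (fst (\<omega> n))"
        using \<pi>n by (intro p.AE_prob_1) simp
      then have "AE a in policy_ext \<pi> n (?h \<omega>). indicator (space (\<X> \<Otimes>\<^sub>M \<A>) - G) (snd (?h \<omega>), a) = (0::ennreal)"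
        unfolding policy_ext_def if_P[OF h] by eventually_elim (simp add: GI[OF x])
      then show "(\<integral>\<^sup>+a. indicator (space (\<X> \<Otimes>\<^sub>M \<A>) - G) (snd (?h \<omega>), a) \<partial>policy_ext \<pi> n (?h \<omega>)) = 0"
        by (subst nn_integral_cong_AE[where v="\<lambda>_. 0"]) simp_all
    qed
    finally have "AE \<omega> in P. \<omega> n \<notin> space (\<X> \<Otimes>\<^sub>M \<A>) - G"
      by (intro AE_notin_if_nn_integral_eq_0[where M="\<X> \<Otimes>\<^sub>M \<A>"]) auto
    then show ?case
      using AE_space by eventually_elim (auto simp: sp space_PiM)
  qed
  then show 1: "AE \<omega> in P. \<forall>k. \<omega> k \<in> G" by (simp add: AE_all_countable)
  show "AE \<omega> in P. \<forall>n. (restrict \<omega> {..<n}, fst (\<omega> n)) \<in> H n"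
    using 1 AE_space by eventually_elim (auto intro: H)
qed

text \<open>Almost every trajectory is admissible under either definition, and there the extended
  kernels coincide with the given ones. The rest is the equivalence of conditional expectations and
  disintegrations.\<close>

lemma is_policy_measure_iff_law:
  assumes \<pi>: "\<pi> \<in> policies D" and x: "x \<in> X"
  shows "is_policy_measure D \<pi> x P \<longleftrightarrow> controlled_process.law \<X> \<A> (policy_ext \<pi>) tr_ext x P"
proof -
  interpret cp: controlled_process \<X> \<A> "policy_ext \<pi>" tr_ext by (rule controlled_process[OF \<pi>])
  have traj: "traj_space D = (\<Pi>\<^sub>M k\<in>UNIV. \<X> \<Otimes>\<^sub>M \<A>)"
    by (simp add: traj_space_def state_action_space_def)
  have hist: "history n = (\<lambda>\<omega>. (restrict \<omega> {..<n}, fst (\<omega> n)))" for n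
    by (simp add: history_def fun_eq_iff)
  have "is_policy_measure D \<pi> x P \<longleftrightarrow> cp.law x P"
    if P: "prob_space P" and s[measurable_cong]: "sets P = sets (\<Pi>\<^sub>M k\<in>UNIV. \<X> \<Otimes>\<^sub>M \<A>)"
  proof -
    interpret prob_space P by fact
    have sp: "space P = space (\<Pi>\<^sub>M k\<in>UNIV. \<X> \<Otimes>\<^sub>M \<A>)" by (rule sets_eq_imp_space_eq[OF s])
    note [measurable] = singleton_sets[OF x]
    have "{\<omega> \<in> space P. fst (\<omega> 0) = x} = {\<omega> \<in> space P. fst (\<omega> 0) \<in> {x}}" by simp
    also have "\<dots> \<in> sets P" by measurable
    finally have init: "measure P {\<omega> \<in> space P. fst (\<omega> 0) = x} = 1 \<longleftrightarrow> (AE \<omega> in P. fst (\<omega> 0) = x)"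
      by (simp add: prob_Collect_eq_1)
    let ?h = "\<lambda>n \<omega>. (restrict \<omega> {..<n}, fst (\<omega> n))"
    have hm: "?h n \<in> P \<rightarrow>\<^sub>M cp.hists n" for n by measurable
    have act: "cond_kernel P (cp.hists n) (?h n) \<A> (\<lambda>\<omega>. snd (\<omega> n)) (policy_ext \<pi> n) \<longleftrightarrow>
      (\<forall>B\<in>sets \<A>. AE \<omega> in P.
        real_cond_exp P (sigma_hist D n) (indicat_real {\<omega> \<in> space P. snd (\<omega> n) \<in> B}) \<omega>
        = measure (\<pi> n (history n \<omega>)) B)" if Hn: "AE \<omega> in P. ?h n \<omega> \<in> H n" for n
    proof -
      have m: "AE \<omega> in P. measure (policy_ext \<pi> n (?h n \<omega>)) B = measure (\<pi> n (history n \<omega>)) B" for B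
        using Hn by eventually_elim (simp add: policy_ext_def hist)
      have "(AE \<omega> in P. u \<omega> = measure (policy_ext \<pi> n (?h n \<omega>)) B) \<longleftrightarrow> (AE \<omega> in P. u \<omega> = measure (\<pi> n (history n \<omega>)) B)"
        for B and u :: "_ \<Rightarrow> real"
        using m[of B] by (intro eventually_subst) (auto elim!: eventually_mono)
      then show ?thesis
        by (subst cond_kernel_iff_real_cond_exp[OF P hm _ policy_ext[OF \<pi>]])
           (simp_all add: sigma_hist_def traj sp hist full_hist_space_eq)
    qed
    have trans: "cond_kernel P (cp.hists n \<Otimes>\<^sub>M \<A>) (\<lambda>\<omega>. (?h n \<omega>, snd (\<omega> n))) \<X> (\<lambda>\<omega>. fst (\<omega> (Suc n)))
        (\<lambda>(h, a). tr_ext (snd h, a)) \<longleftrightarrow>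
      (\<forall>B\<in>sets \<X>. AE \<omega> in P.
        real_cond_exp P (sigma_hist_action D n) (indicat_real {\<omega> \<in> space P. fst (\<omega> (Suc n)) \<in> B}) \<omega>
        = measure (tr_kernel D (\<omega> n)) B)" if Gn: "AE \<omega> in P. \<omega> n \<in> G" for n
    proof -
      have m: "AE \<omega> in P. measure (tr_ext (\<omega> n)) B = measure (tr_kernel D (\<omega> n)) B" for B
        using Gn by eventually_elim (simp add: tr_ext_def)
      have "(AE \<omega> in P. u \<omega> = measure (tr_ext (\<omega> n)) B) \<longleftrightarrow> (AE \<omega> in P. u \<omega> = measure (tr_kernel D (\<omega> n)) B)"
        for B and u :: "_ \<Rightarrow> real"
        using m[of B] by (intro eventually_subst) (auto elim!: eventually_mono)
      moreover have "(\<lambda>(h, a). tr_ext (snd h, a)) \<in> cp.hists n \<Otimes>\<^sub>M \<A> \<rightarrow>\<^sub>M prob_algebra \<X>"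
        using tr_ext by measurable
      ultimately show ?thesis
        by (subst cond_kernel_iff_real_cond_exp[OF P])
           (simp_all add: sigma_hist_action_def traj sp hist full_hist_space_eq)
    qed
    show ?thesis
    proof
      assume pm: "is_policy_measure D \<pi> x P"
      have ck: "cond_kernel P (cp.hists n) (?h n) \<A> (\<lambda>\<omega>. snd (\<omega> n)) (policy_ext \<pi> n)"
        if "AE \<omega> in P. ?h n \<omega> \<in> H n" for n
        using pm act[OF that] by (simp add: is_policy_measure_def)
      note AE = AE_graph[OF \<pi> P s ck]
      have "AE \<omega> in P. \<omega> n \<in> G" "AE \<omega> in P. ?h n \<omega> \<in> H n" for n
        by (rule eventually_mono[OF AE(1)]; simp) (rule eventually_mono[OF AE(2)]; simp)
      with pm init ck trans P s show "cp.law x P"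
        by (simp add: cp.law_def is_policy_measure_def)
    next
      assume pm: "cp.law x P"
      have ck: "cond_kernel P (cp.hists n) (?h n) \<A> (\<lambda>\<omega>. snd (\<omega> n)) (policy_ext \<pi> n)" for n
        using pm by (simp add: cp.law_def)
      note AE = AE_graph[OF \<pi> P s ck]
      have "AE \<omega> in P. \<omega> n \<in> G" "AE \<omega> in P. ?h n \<omega> \<in> H n" for n
        by (rule eventually_mono[OF AE(1)]; simp) (rule eventually_mono[OF AE(2)]; simp)
      with pm init act trans P s show "is_policy_measure D \<pi> x P"
        by (simp add: cp.law_def is_policy_measure_def traj)
    qed
  qed
  then show ?thesis
    unfolding is_policy_measure_def cp.law_def traj by blast
qed

text \<open>Existence and uniqueness of \<open>law\<close> give the \<open>THE\<close> in
  \<open>policy_measure\<close> its meaning. Later arguments reach the trajectory measure only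
  through the facts collected here.\<close>

lemma policy_measure:
  assumes \<pi>: "\<pi> \<in> policies D" and x: "x \<in> X"
  shows "prob_space (policy_measure D \<pi> x)"
    and "sets (policy_measure D \<pi> x) = sets (\<Pi>\<^sub>M k\<in>UNIV. \<X> \<Otimes>\<^sub>M \<A>)"
    and "AE \<omega> in policy_measure D \<pi> x. fst (\<omega> 0) = x"
    and "AE \<omega> in policy_measure D \<pi> x. \<forall>k. \<omega> k \<in> G"
    and "g \<in> borel_measurable \<X> \<Longrightarrow> (\<integral>\<^sup>+\<omega>. g (fst (\<omega> (Suc n))) \<partial>policy_measure D \<pi> x) =
       (\<integral>\<^sup>+\<omega>. (\<integral>\<^sup>+y. g y \<partial>tr_kernel D (\<omega> n)) \<partial>policy_measure D \<pi> x)"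
    and "f \<in> selectors D \<Longrightarrow> \<pi> = stationary D f \<Longrightarrow> AE \<omega> in policy_measure D \<pi> x. \<forall>k. snd (\<omega> k) = f (fst (\<omega> k))"
proof -
  interpret cp: controlled_process \<X> \<A> "policy_ext \<pi>" tr_ext by (rule controlled_process[OF \<pi>])
  let ?P = "policy_measure D \<pi> x"
  have "\<exists>!P. cp.law x P"
    using x cp.law_exists[of x] cp.law_unique[of x] singleton_sets[OF x] by (auto simp: space_X)
  then have "\<exists>!P. is_policy_measure D \<pi> x P"
    by (simp add: is_policy_measure_iff_law[OF \<pi> x])
  then have "is_policy_measure D \<pi> x ?P"
    unfolding policy_measure_def by (rule theI')
  then have law: "cp.law x ?P" by (simp add: is_policy_measure_iff_law[OF \<pi> x])
  then show P: "prob_space ?P" and s[measurable_cong]: "sets ?P = sets (\<Pi>\<^sub>M k\<in>UNIV. \<X> \<Otimes>\<^sub>M \<A>)"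
    and "AE \<omega> in ?P. fst (\<omega> 0) = x"
    by (simp_all add: cp.law_def)
  have ck: "cond_kernel ?P (cp.hists n) (cp.hist n) \<A> (\<lambda>\<omega>. snd (\<omega> n)) (policy_ext \<pi> n)" for n
    using law by (simp add: cp.law_def)
  note AE = AE_graph[OF \<pi> P s ck]
  show "AE \<omega> in ?P. \<forall>k. \<omega> k \<in> G" by (rule AE)
  show "(\<integral>\<^sup>+\<omega>. g (fst (\<omega> (Suc n))) \<partial>?P) = (\<integral>\<^sup>+\<omega>. (\<integral>\<^sup>+y. g y \<partial>tr_kernel D (\<omega> n)) \<partial>?P)"
    if g[measurable]: "g \<in> borel_measurable \<X>"
  proof -
    have "cond_kernel ?P (cp.hists n \<Otimes>\<^sub>M \<A>) (\<lambda>\<omega>. (cp.hist n \<omega>, snd (\<omega> n))) \<X> (\<lambda>\<omega>. fst (\<omega> (Suc n)))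
        (\<lambda>(h, a). tr_ext (snd h, a))"
      using law by (simp add: cp.law_def)
    from cond_kernelD[OF this, of "\<lambda>_ y. g y"]
    have "(\<integral>\<^sup>+\<omega>. g (fst (\<omega> (Suc n))) \<partial>?P) = (\<integral>\<^sup>+\<omega>. (\<integral>\<^sup>+y. g y \<partial>tr_ext (\<omega> n)) \<partial>?P)"
      by simp
    also have "\<dots> = (\<integral>\<^sup>+\<omega>. (\<integral>\<^sup>+y. g y \<partial>tr_kernel D (\<omega> n)) \<partial>?P)"
      using AE(1) by (intro nn_integral_cong_AE) (auto simp: tr_ext_def elim!: eventually_mono)
    finally show ?thesis .
  qed
  show "AE \<omega> in ?P. \<forall>k. snd (\<omega> k) = f (fst (\<omega> k))" if f: "f \<in> selectors D" and \<pi>f: "\<pi> = stationary D f"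
    unfolding AE_all_countable
  proof
    fix k
    note [measurable] = selectorsD(1)[OF f]
    let ?B = "{(y, a). y \<in> X \<and> a \<in> A \<and> a \<noteq> f y}"
    \<comment> \<open>The complement of the graph of \<open>f\<close> is a preimage of the
      complement of the diagonal, which is open because the action space is Hausdorff.\<close>
    have B[measurable]: "?B \<in> sets (\<X> \<Otimes>\<^sub>M \<A>)"
    proof -
      have "(\<lambda>z. (snd z, f (fst z))) \<in> \<X> \<Otimes>\<^sub>M \<A> \<rightarrow>\<^sub>M borel"
        using selectorsD(1)[OF f]
        by (intro borel_measurable_Pair measurable_compose[OF measurable_fst] measurable_compose[OF measurable_snd])
           (auto simp: measurable_restrict_space2_iff intro!: measurable_restrict_space1)
      moreover have "{z::'a \<times> 'a. fst z \<noteq> snd z} \<in> sets borel"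
        by (intro borel_open open_Collect_neq continuous_intros)
      ultimately have "(\<lambda>z. (snd z, f (fst z))) -` {z. fst z \<noteq> snd z} \<inter> space (\<X> \<Otimes>\<^sub>M \<A>) \<in> sets (\<X> \<Otimes>\<^sub>M \<A>)"
        by (rule measurable_sets)
      also have "(\<lambda>z. (snd z, f (fst z))) -` {z. fst z \<noteq> snd z} \<inter> space (\<X> \<Otimes>\<^sub>M \<A>) = ?B"
        by (auto simp: space_pair_measure space_X space_A)
      finally show ?thesis .
    qed
    have "(\<integral>\<^sup>+\<omega>. indicator ?B (snd (cp.hist k \<omega>), snd (\<omega> k)) \<partial>?P) =
       (\<integral>\<^sup>+\<omega>. (\<integral>\<^sup>+a. indicator ?B (snd (cp.hist k \<omega>), a) \<partial>policy_ext \<pi> k (cp.hist k \<omega>)) \<partial>?P)"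
      by (rule cond_kernelD[OF ck, of "\<lambda>h a. indicator ?B (snd h, a)"]) measurable
    also have "\<dots> = (\<integral>\<^sup>+\<omega>. 0 \<partial>?P)"
    proof (rule nn_integral_cong_AE, use AE(2) in eventually_elim)
      fix \<omega> assume "\<forall>n. cp.hist n \<omega> \<in> H n"
      then have h: "cp.hist k \<omega> \<in> H k" and x: "fst (\<omega> k) \<in> X" by (auto simp: space_hist)
      then have "f (fst (\<omega> k)) \<in> A" using selectorsD(3)[OF f] G_D(3) by fastforce
      then show "(\<integral>\<^sup>+a. indicator ?B (snd (cp.hist k \<omega>), a) \<partial>policy_ext \<pi> k (cp.hist k \<omega>)) = 0"
        using h x measurable_compose[OF measurable_Pair1' borel_measurable_indicator[OF B], of "fst (\<omega> k)"]
        by (subst policy_ext_def) (simp add: \<pi>f stationary_def nn_integral_return space_A space_X)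
    qed
    finally have "AE \<omega> in ?P. \<omega> k \<notin> ?B"
      by (intro AE_notin_if_nn_integral_eq_0[where M="\<X> \<Otimes>\<^sub>M \<A>"]) auto
    with AE(1) show "AE \<omega> in ?P. snd (\<omega> k) = f (fst (\<omega> k))"
      by eventually_elim (use G_D in \<open>auto simp: split_beta'\<close>)
  qed
qed

lemma stationary_policy:
  assumes f: "f \<in> selectors D"
  shows "stationary D f \<in> policies D"
  unfolding policies_def
proof (safe)
  note [measurable] = selectorsD(1)[OF f]
  fix n
  show "stationary D f n \<in> hist_space D n \<rightarrow>\<^sub>M prob_algebra \<A>"
    unfolding stationary_def hist_space_def by measurable
  fix r y assume "(r, y) \<in> H n"
  then have "y \<in> X" by (simp add: space_hist)
  then show "measure (stationary D f n (r, y)) (adm D (snd (r, y))) = 1"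
    using selectorsD(2)[OF f] by (simp add: stationary_def measure_return adm_sets)
qed

end

section \<open>Value functions\<close>

text \<open>Measurability of \<open>W\<close> is listed separately because
  \<open>growth_conditions\<close> does not state it; in the theorem it comes from
  continuity.\<close>

locale growth_model = decision_model D f0
  for D :: "('x::polish_space, 'a::polish_space) mdm" and f0 :: "'x \<Rightarrow> 'a" +
  fixes M \<beta> :: real and W :: "'x \<Rightarrow> real"
  assumes growth: "growth_conditions D M \<beta> W"
    and W_measurable[measurable]: "W \<in> borel_measurable (borel_on (states D))"
begin

abbreviation "\<alpha> \<equiv> discount D"
abbreviation "\<gamma> \<equiv> \<beta> * \<alpha>"

lemma M_pos: "0 < M" and \<beta>: "1 < \<beta>" and \<gamma>: "0 < \<gamma>" "\<gamma> < 1"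
  and W_ge_1: "x \<in> X \<Longrightarrow> 1 \<le> W x"
  and cost_bound: "z \<in> G \<Longrightarrow> \<bar>cost D z\<bar> \<le> M * W (fst z)"
  and W_integrable: "z \<in> G \<Longrightarrow> integrable (tr_kernel D z) W"
  and QW_bound: "z \<in> G \<Longrightarrow> Qop D W z \<le> \<beta> * W (fst z)"
  using growth discount by (auto simp: growth_conditions_def)

lemma W_nonneg: "x \<in> X \<Longrightarrow> 0 \<le> W x"
  using W_ge_1 by fastforce

section \<open>Functions bounded by a multiple of the weight\<close>

text \<open>The ball of radius \<open>c\<close> in B_W(X). The radius is explicit because one and
  the same has to serve for all iterates.\<close>

definition W_bounded :: "real \<Rightarrow> ('x \<Rightarrow> real) \<Rightarrow> bool" where
  "W_bounded c u \<longleftrightarrow> u \<in> borel_measurable \<X> \<and> (\<forall>x\<in>X. \<bar>u x\<bar> \<le> c * W x)"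

lemma W_boundedD: "W_bounded c u \<Longrightarrow> u \<in> borel_measurable \<X>" "W_bounded c u \<Longrightarrow> x \<in> X \<Longrightarrow> \<bar>u x\<bar> \<le> c * W x"
  by (simp_all add: W_bounded_def)

lemma W_bounded_nonneg:
  assumes "W_bounded c u" "x \<in> X"
  shows "0 \<le> c"
proof -
  have "0 \<le> c * W x" using W_boundedD(2)[OF assms] by linarith
  then show ?thesis using W_ge_1[OF assms(2)] by (simp add: zero_le_mult_iff)
qed

lemma W_bounded_scaleW: "W_bounded \<bar>c\<bar> (\<lambda>x. c * W x)"
  using W_ge_1 by (force simp: W_bounded_def abs_mult)

lemma tr_kernel:
  assumes z: "z \<in> G"
  shows "prob_space (tr_kernel D z)" "sets (tr_kernel D z) = sets \<X>" "space (tr_kernel D z) = X"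
proof -
  have "tr_kernel D z \<in> space (prob_algebra \<X>)"
    using z by (intro measurable_space[OF tr]) (simp add: space_restrict_space)
  then show "prob_space (tr_kernel D z)" "sets (tr_kernel D z) = sets \<X>"
    by (simp_all add: space_prob_algebra)
  then show "space (tr_kernel D z) = X" using sets_eq_imp_space_eq space_X by blast
qed

lemma W_bounded_integrable:
  assumes u: "W_bounded c u" and z: "z \<in> G"
  shows "integrable (tr_kernel D z) u"
proof (rule Bochner_Integration.integrable_bound)
  show "integrable (tr_kernel D z) (\<lambda>y. c * W y)" using W_integrable[OF z] by simp
  show "u \<in> borel_measurable (tr_kernel D z)"
    using W_boundedD(1)[OF u] by (simp cong: measurable_cong_sets add: tr_kernel(2)[OF z])
  show "AE y in tr_kernel D z. norm (u y) \<le> norm (c * W y)"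
    using W_boundedD(2)[OF u] by (intro AE_I2) (fastforce simp: tr_kernel(3)[OF z])
qed

lemma Qop_mono:
  assumes "W_bounded c u" "W_bounded d v" "z \<in> G" "\<And>y. y \<in> X \<Longrightarrow> u y \<le> v y"
  shows "Qop D u z \<le> Qop D v z"
  unfolding Qop_def using assms
  by (intro integral_mono W_bounded_integrable) (auto simp: tr_kernel(3))

lemma Qop_cong: "z \<in> G \<Longrightarrow> (\<And>y. y \<in> X \<Longrightarrow> u y = v y) \<Longrightarrow> Qop D u z = Qop D v z"
  unfolding Qop_def by (intro Bochner_Integration.integral_cong) (auto simp: tr_kernel(3))

lemma Qop_scaleW: "Qop D (\<lambda>x. c * W x) z = c * Qop D W z"
  by (simp add: Qop_def)

lemma Qop_bound:
  assumes u: "W_bounded c u" and z: "z \<in> G"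
  shows "\<bar>Qop D u z\<bar> \<le> c * \<beta> * W (fst z)"
proof -
  have c: "0 \<le> c" using W_bounded_nonneg[OF u] G_D(1)[OF z] .
  have "\<bar>Qop D u z\<bar> \<le> (\<integral>y. \<bar>u y\<bar> \<partial>tr_kernel D z)"
    unfolding Qop_def by (rule integral_abs_bound)
  also have "\<dots> \<le> (\<integral>y. c * W y \<partial>tr_kernel D z)"
    using W_boundedD(2)[OF u] W_integrable[OF z] W_bounded_integrable[OF u z]
    by (intro integral_mono) (auto simp: tr_kernel(3)[OF z])
  also have "\<dots> = c * Qop D W z" by (simp add: Qop_def)
  also have "\<dots> \<le> c * (\<beta> * W (fst z))" using QW_bound[OF z] c by (intro mult_left_mono)
  finally show ?thesis by (simp add: mult.assoc)
qed

lemma Qop_measurable: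
  assumes u: "u \<in> borel_measurable \<X>"
  shows "Qop D u \<in> borel_measurable (borel_on G)"
  unfolding Qop_def[abs_def]
  by (rule measurable_compose[OF measurable_prob_algebraD[OF tr] integral_measurable_subprob_algebra[OF u]])

text \<open>This is the zero extension that also occurs in \<open>policy_value\<close>; it makes
  functions on the graph measurable on the whole product.\<close>

definition on_graph :: "('x \<times> 'a \<Rightarrow> real) \<Rightarrow> 'x \<times> 'a \<Rightarrow> real" where
  "on_graph g z = (if z \<in> G then g z else 0)"

lemma on_graph_measurable[measurable (raw)]:
  "g \<in> borel_measurable (borel_on G) \<Longrightarrow> on_graph g \<in> borel_measurable (\<X> \<Otimes>\<^sub>M \<A>)"
  unfolding on_graph_def[abs_def] by (rule measurable_on_graph) auto

section \<open>Weighted moments and discounted sums along a process\<close>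

context
  fixes \<pi> x
  assumes \<pi>: "\<pi> \<in> policies D" and x: "x \<in> X"
begin

abbreviation "P \<equiv> policy_measure D \<pi> x"

interpretation P: prob_space P by (rule policy_measure(1)[OF \<pi> x])

lemma process_measurable:
  "(\<lambda>\<omega>. \<omega> n) \<in> P \<rightarrow>\<^sub>M \<X> \<Otimes>\<^sub>M \<A>" "(\<lambda>\<omega>. fst (\<omega> n)) \<in> P \<rightarrow>\<^sub>M \<X>"
proof -
  show 1: "(\<lambda>\<omega>. \<omega> n) \<in> P \<rightarrow>\<^sub>M \<X> \<Otimes>\<^sub>M \<A>"
    by (subst measurable_cong_sets[OF policy_measure(2)[OF \<pi> x] refl])
       (simp add: measurable_component_singleton)
  show "(\<lambda>\<omega>. fst (\<omega> n)) \<in> P \<rightarrow>\<^sub>M \<X>"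
    by (rule measurable_compose[OF 1 measurable_fst])
qed

lemma process_in_X: "\<omega> \<in> space P \<Longrightarrow> fst (\<omega> n) \<in> X"
  using measurable_space[OF process_measurable(2)] by (simp add: space_X)

lemmas [measurable] = process_measurable

text \<open>Each transition multiplies the mean weight by at most \<beta>, since QW \<le> \<beta> W.
  The induction runs in \<open>ennreal\<close> because integrability of the weight along the process
  is obtained from it.\<close>

lemma nn_integral_W_process: "(\<integral>\<^sup>+\<omega>. ennreal (W (fst (\<omega> n))) \<partial>P) \<le> ennreal (\<beta> ^ n * W x)"
proof (induction n)
  case 0
  have "(\<integral>\<^sup>+\<omega>. ennreal (W (fst (\<omega> 0))) \<partial>P) = (\<integral>\<^sup>+\<omega>. ennreal (W x) \<partial>P)"
    using policy_measure(3)[OF \<pi> x] by (intro nn_integral_cong_AE) (auto elim!: eventually_mono)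
  then show ?case by (simp add: P.emeasure_space_1)
next
  case (Suc n)
  have "(\<integral>\<^sup>+\<omega>. ennreal (W (fst (\<omega> (Suc n)))) \<partial>P) = (\<integral>\<^sup>+\<omega>. (\<integral>\<^sup>+y. ennreal (W y) \<partial>tr_kernel D (\<omega> n)) \<partial>P)"
    by (rule policy_measure(5)[OF \<pi> x]) simp
  also have "\<dots> \<le> (\<integral>\<^sup>+\<omega>. ennreal \<beta> * ennreal (W (fst (\<omega> n))) \<partial>P)"
  proof (rule nn_integral_mono_AE, use policy_measure(4)[OF \<pi> x] in eventually_elim)
    fix \<omega> assume "\<forall>k::nat. \<omega> k \<in> G"
    then have z: "\<omega> n \<in> G" by simp
    have "(\<integral>\<^sup>+y. ennreal (W y) \<partial>tr_kernel D (\<omega> n)) = ennreal (Qop D W (\<omega> n))"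
      unfolding Qop_def
      by (intro nn_integral_eq_integral W_integrable z AE_I2 W_nonneg) (simp add: tr_kernel(3)[OF z])
    also have "\<dots> \<le> ennreal (\<beta> * W (fst (\<omega> n)))"
      using QW_bound[OF z] by (rule ennreal_leI)
    finally show "(\<integral>\<^sup>+y. ennreal (W y) \<partial>tr_kernel D (\<omega> n)) \<le> ennreal \<beta> * ennreal (W (fst (\<omega> n)))"
      using \<beta> by (simp add: ennreal_mult')
  qed
  also have "\<dots> = ennreal \<beta> * (\<integral>\<^sup>+\<omega>. ennreal (W (fst (\<omega> n))) \<partial>P)"
    by (rule nn_integral_cmult) measurable
  also have "\<dots> \<le> ennreal \<beta> * ennreal (\<beta> ^ n * W x)"
    by (intro mult_left_mono Suc) simp
  also have "\<dots> = ennreal (\<beta> ^ Suc n * W x)"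
    using \<beta> by (simp add: ennreal_mult'[symmetric] mult.assoc)
  finally show ?case .
qed

lemma W_process_integrable: "integrable P (\<lambda>\<omega>. W (fst (\<omega> n)))"
proof (rule integrableI_nonneg)
  show "AE \<omega> in P. 0 \<le> W (fst (\<omega> n))"
    by (intro AE_I2 W_nonneg process_in_X)
  show "(\<integral>\<^sup>+\<omega>. ennreal (W (fst (\<omega> n))) \<partial>P) < \<infinity>"
    using nn_integral_W_process[of n] by (auto simp: less_top[symmetric] top_unique)
qed measurable

lemma integral_W_process: "(\<integral>\<omega>. W (fst (\<omega> n)) \<partial>P) \<le> \<beta> ^ n * W x"
proof -
  have "ennreal (\<integral>\<omega>. W (fst (\<omega> n)) \<partial>P) = (\<integral>\<^sup>+\<omega>. ennreal (W (fst (\<omega> n))) \<partial>P)"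
    by (intro nn_integral_eq_integral[symmetric] W_process_integrable AE_I2 W_nonneg process_in_X)
  then have "ennreal (\<integral>\<omega>. W (fst (\<omega> n)) \<partial>P) \<le> ennreal (\<beta> ^ n * W x)"
    using nn_integral_W_process[of n] by (simp only:)
  moreover have "0 \<le> \<beta> ^ n * W x" using W_nonneg[OF x] \<beta> by simp
  ultimately show ?thesis by (simp only: ennreal_le_iff)
qed

lemma dominated_process:
  assumes [measurable]: "h \<in> borel_measurable (\<X> \<Otimes>\<^sub>M \<A>)"
    and b: "\<And>z. fst z \<in> X \<Longrightarrow> \<bar>h z\<bar> \<le> c * W (fst z)"
  shows "integrable P (\<lambda>\<omega>. h (\<omega> n))" and "(\<integral>\<omega>. \<bar>h (\<omega> n)\<bar> \<partial>P) \<le> c * (\<beta> ^ n * W x)"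
    and "\<bar>\<integral>\<omega>. h (\<omega> n) \<partial>P\<bar> \<le> c * (\<beta> ^ n * W x)"
proof -
  \<comment> \<open>The bound is assumed for every second coordinate, so \<open>undefined\<close>
    may stand in for the action.\<close>
  have c: "0 \<le> c"
    using b[of "(x, undefined)"] W_ge_1[OF x] x by (auto simp: zero_le_mult_iff dest: order_trans[OF abs_ge_zero])
  show i: "integrable P (\<lambda>\<omega>. h (\<omega> n))"
    using b[OF process_in_X]
    by (intro Bochner_Integration.integrable_bound[OF integrable_mult_right[OF W_process_integrable, of c n]] AE_I2)
       (auto intro: order_trans[OF _ abs_ge_self])
  have "(\<integral>\<omega>. \<bar>h (\<omega> n)\<bar> \<partial>P) \<le> (\<integral>\<omega>. c * W (fst (\<omega> n)) \<partial>P)"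
    using b[OF process_in_X] i W_process_integrable by (intro integral_mono) auto
  also have "\<dots> = c * (\<integral>\<omega>. W (fst (\<omega> n)) \<partial>P)" by simp
  also have "\<dots> \<le> c * (\<beta> ^ n * W x)" using integral_W_process c by (intro mult_left_mono)
  finally show *: "(\<integral>\<omega>. \<bar>h (\<omega> n)\<bar> \<partial>P) \<le> c * (\<beta> ^ n * W x)" .
  show "\<bar>\<integral>\<omega>. h (\<omega> n) \<partial>P\<bar> \<le> c * (\<beta> ^ n * W x)"
    using integral_abs_bound[of P "\<lambda>\<omega>. h (\<omega> n)"] * by linarith
qed

lemma W_bounded_process:
  assumes u: "W_bounded c u"
  shows "integrable P (\<lambda>\<omega>. u (fst (\<omega> n)))" and "\<bar>\<integral>\<omega>. u (fst (\<omega> n)) \<partial>P\<bar> \<le> c * (\<beta> ^ n * W x)"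
proof -
  have m: "(\<lambda>z. u (fst z)) \<in> borel_measurable (\<X> \<Otimes>\<^sub>M \<A>)"
    using W_boundedD(1)[OF u] by measurable
  show "integrable P (\<lambda>\<omega>. u (fst (\<omega> n)))" "\<bar>\<integral>\<omega>. u (fst (\<omega> n)) \<partial>P\<bar> \<le> c * (\<beta> ^ n * W x)"
    using dominated_process(1,3)[OF m W_boundedD(2)[OF u], where n=n] by auto
qed

lemma Qop_process_integrable:
  assumes u: "W_bounded c u"
  shows "integrable P (\<lambda>\<omega>. on_graph (Qop D u) (\<omega> n))"
proof (rule dominated_process(1))
  show "on_graph (Qop D u) \<in> borel_measurable (\<X> \<Otimes>\<^sub>M \<A>)"
    by (intro on_graph_measurable Qop_measurable W_boundedD(1)[OF u])
  show "\<bar>on_graph (Qop D u) z\<bar> \<le> c * \<beta> * W (fst z)" if "fst z \<in> X" for z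
    using Qop_bound[OF u, of z] W_bounded_nonneg[OF u that] W_ge_1[OF that] \<beta> by (simp add: on_graph_def)
qed

lemma cost_process_integrable:
  shows "integrable P (\<lambda>\<omega>. on_graph (cost D) (\<omega> n))"
    and "(\<integral>\<omega>. \<bar>on_graph (cost D) (\<omega> n)\<bar> \<partial>P) \<le> M * (\<beta> ^ n * W x)"
proof -
  have "\<bar>on_graph (cost D) z\<bar> \<le> M * W (fst z)" if "fst z \<in> X" for z
    using cost_bound[of z] W_ge_1[OF that] M_pos by (simp add: on_graph_def)
  from dominated_process(1,2)[OF on_graph_measurable[OF cost] this]
  show "integrable P (\<lambda>\<omega>. on_graph (cost D) (\<omega> n))" "(\<integral>\<omega>. \<bar>on_graph (cost D) (\<omega> n)\<bar> \<partial>P) \<le> M * (\<beta> ^ n * W x)"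
    by auto
qed

text \<open>The transition identity is known for nonnegative integrands. A signed \<open>u\<close>
  is written as the difference of u + c W and c W, both nonnegative by the bound on
  \<open>u\<close>.\<close>

lemma integral_process_Suc:
  assumes u: "W_bounded c u"
  shows "(\<integral>\<omega>. u (fst (\<omega> (Suc n))) \<partial>P) = (\<integral>\<omega>. on_graph (Qop D u) (\<omega> n) \<partial>P)"
proof -
  have nonneg: "(\<integral>\<omega>. w (fst (\<omega> (Suc n))) \<partial>P) = (\<integral>\<omega>. on_graph (Qop D w) (\<omega> n) \<partial>P)"
    if w: "W_bounded d w" and w0: "\<And>y. y \<in> X \<Longrightarrow> 0 \<le> w y" for d w
  proof -
    note [measurable] = W_boundedD(1)[OF w]
    have Q0: "0 \<le> on_graph (Qop D w) z" for z
      using w0 by (auto simp: on_graph_def Qop_def tr_kernel(3) intro!: Bochner_Integration.integral_nonneg)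
    have "ennreal (\<integral>\<omega>. w (fst (\<omega> (Suc n))) \<partial>P) = (\<integral>\<^sup>+\<omega>. ennreal (w (fst (\<omega> (Suc n)))) \<partial>P)"
      using w0 process_in_X by (intro nn_integral_eq_integral[symmetric] W_bounded_process[OF w] AE_I2) auto
    also have "\<dots> = (\<integral>\<^sup>+\<omega>. (\<integral>\<^sup>+y. ennreal (w y) \<partial>tr_kernel D (\<omega> n)) \<partial>P)"
      by (rule policy_measure(5)[OF \<pi> x]) simp
    also have "\<dots> = (\<integral>\<^sup>+\<omega>. ennreal (on_graph (Qop D w) (\<omega> n)) \<partial>P)"
    proof (rule nn_integral_cong_AE, use policy_measure(4)[OF \<pi> x] in eventually_elim)
      fix \<omega> assume "\<forall>k::nat. \<omega> k \<in> G"
      then have z: "\<omega> n \<in> G" by simp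
      show "(\<integral>\<^sup>+y. ennreal (w y) \<partial>tr_kernel D (\<omega> n)) = ennreal (on_graph (Qop D w) (\<omega> n))"
        unfolding Qop_def on_graph_def if_P[OF z]
        using w0 by (intro nn_integral_eq_integral W_bounded_integrable[OF w] z AE_I2) (auto simp: tr_kernel(3)[OF z])
    qed
    also have "\<dots> = ennreal (\<integral>\<omega>. on_graph (Qop D w) (\<omega> n) \<partial>P)"
      using Q0 by (intro nn_integral_eq_integral Qop_process_integrable[OF w] AE_I2) auto
    finally show ?thesis
      using w0 process_in_X Q0 by (subst (asm) ennreal_inj) (auto intro!: Bochner_Integration.integral_nonneg)
  qed
  let ?w = "\<lambda>y. u y + c * W y" and ?v = "\<lambda>y. c * W y"
  have c: "0 \<le> c" using W_bounded_nonneg[OF u x] .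
  have w: "W_bounded (c + c) ?w"
    using W_boundedD[OF u] by (fastforce simp: W_bounded_def distrib_right)
  have v: "W_bounded c ?v" using W_bounded_scaleW[of c] c by simp
  have "(\<integral>\<omega>. u (fst (\<omega> (Suc n))) \<partial>P) = (\<integral>\<omega>. ?w (fst (\<omega> (Suc n))) \<partial>P) - (\<integral>\<omega>. ?v (fst (\<omega> (Suc n))) \<partial>P)"
    by (subst Bochner_Integration.integral_diff[symmetric])
       (use W_bounded_process(1)[OF w] W_bounded_process(1)[OF v] in auto)
  also have "\<dots> = (\<integral>\<omega>. on_graph (Qop D ?w) (\<omega> n) \<partial>P) - (\<integral>\<omega>. on_graph (Qop D ?v) (\<omega> n) \<partial>P)"
    using W_boundedD(2)[OF u] W_boundedD(2)[OF v]
    by (intro arg_cong2[where f=minus] nonneg[OF w] nonneg[OF v]) (fastforce, metis abs_ge_zero mult_nonneg_nonneg c W_ge_1 order_trans zero_le_one)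
  also have "\<dots> = (\<integral>\<omega>. on_graph (Qop D u) (\<omega> n) \<partial>P)"
  proof (subst Bochner_Integration.integral_diff[symmetric])
    have "on_graph (Qop D ?w) z - on_graph (Qop D ?v) z = on_graph (Qop D u) z" for z
      using Bochner_Integration.integral_add[OF W_bounded_integrable[OF u] W_bounded_integrable[OF v], of z]
      by (simp add: on_graph_def Qop_def)
    then show "(\<integral>\<omega>. on_graph (Qop D ?w) (\<omega> n) - on_graph (Qop D ?v) (\<omega> n) \<partial>P) = (\<integral>\<omega>. on_graph (Qop D u) (\<omega> n) \<partial>P)"
      by simp
  qed (rule Qop_process_integrable[OF w] Qop_process_integrable[OF v])+
  finally show ?thesis .
qed

text \<open>Expectation and series may be exchanged: the mean of the k-th discounted absolute cost
  is at most M W(x) \<gamma>^k, a summable geometric bound.\<close>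

lemma policy_value_sums:
  "(\<lambda>k. \<alpha> ^ k * (\<integral>\<omega>. on_graph (cost D) (\<omega> k) \<partial>P)) sums policy_value D \<pi> x"
proof -
  let ?f = "\<lambda>k \<omega>. \<alpha> ^ k * on_graph (cost D) (\<omega> k)"
  have \<alpha>: "0 \<le> \<alpha>" using discount by simp
  have i: "integrable P (?f k)" for k
    using cost_process_integrable(1) by simp
  have b: "(\<integral>\<omega>. norm (?f k \<omega>) \<partial>P) \<le> M * W x * \<gamma> ^ k" for k
  proof -
    have "(\<integral>\<omega>. norm (?f k \<omega>) \<partial>P) = \<alpha> ^ k * (\<integral>\<omega>. \<bar>on_graph (cost D) (\<omega> k)\<bar> \<partial>P)"
      using \<alpha> by (simp add: abs_mult)
    also have "\<dots> \<le> \<alpha> ^ k * (M * (\<beta> ^ k * W x))"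
      using cost_process_integrable(2) \<alpha> by (intro mult_left_mono) auto
    finally show ?thesis by (simp add: power_mult_distrib mult_ac)
  qed
  have geo: "summable (\<lambda>k. M * W x * \<gamma> ^ k)"
    using \<gamma> by (intro summable_mult summable_geometric) auto
  have s: "summable (\<lambda>k. \<integral>\<omega>. norm (?f k \<omega>) \<partial>P)"
    using b by (intro summable_comparison_test'[OF geo, of 0]) (auto simp: Bochner_Integration.integral_nonneg)
  \<comment> \<open>Integrating the series of absolute values term by term gives a finite mean, so
    this series is finite almost everywhere.\<close>
  have "AE \<omega> in P. summable (\<lambda>k. norm (?f k \<omega>))"
  proof -
    have "(\<integral>\<^sup>+\<omega>. (\<Sum>k. ennreal (norm (?f k \<omega>))) \<partial>P) = (\<Sum>k. \<integral>\<^sup>+\<omega>. ennreal (norm (?f k \<omega>)) \<partial>P)"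
      using borel_measurable_integrable[OF i] by (intro nn_integral_suminf) auto
    also have "\<dots> = (\<Sum>k. ennreal (\<integral>\<omega>. norm (?f k \<omega>) \<partial>P))"
      using i by (intro suminf_cong nn_integral_eq_integral) auto
    also have "\<dots> = ennreal (\<Sum>k. \<integral>\<omega>. norm (?f k \<omega>) \<partial>P)"
      by (rule suminf_ennreal2[OF _ s]) (simp add: Bochner_Integration.integral_nonneg)
    finally have "(\<integral>\<^sup>+\<omega>. (\<Sum>k. ennreal (norm (?f k \<omega>))) \<partial>P) \<noteq> \<infinity>" by simp
    then have "AE \<omega> in P. (\<Sum>k. ennreal (norm (?f k \<omega>))) \<noteq> \<infinity>"
      using borel_measurable_integrable[OF i] by (intro nn_integral_PInf_AE) auto
    then show ?thesis
      by eventually_elim (auto intro!: summable_suminf_not_top)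
  qed
  from sums_integral[OF i this s] show ?thesis
    by (simp add: policy_value_def on_graph_def cong: if_cong)
qed

text \<open>By \<open>integral_process_Suc\<close> the k-th term is \<alpha>^k E u(x_k) -
  \<alpha>^(k+1) E u(x_(k+1)). The boundary term is at most c W(x) \<gamma>^k in absolute value and
  vanishes because \<gamma> < 1.\<close>

lemma telescoping_process:
  assumes u: "W_bounded c u"
  shows "(\<lambda>k. \<alpha> ^ k * ((\<integral>\<omega>. u (fst (\<omega> k)) \<partial>P) - \<alpha> * (\<integral>\<omega>. on_graph (Qop D u) (\<omega> k) \<partial>P))) sums u x"
proof -
  let ?e = "\<lambda>k. \<alpha> ^ k * (\<integral>\<omega>. u (fst (\<omega> k)) \<partial>P)"
  have "?e \<longlonglongrightarrow> 0"
  proof (rule Lim_null_comparison)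
    show "eventually (\<lambda>k. norm (?e k) \<le> c * W x * \<gamma> ^ k) sequentially"
    proof (rule always_eventually, rule allI)
      fix k
      have "norm (?e k) = \<alpha> ^ k * \<bar>\<integral>\<omega>. u (fst (\<omega> k)) \<partial>P\<bar>" using discount by (simp add: abs_mult)
      also have "\<dots> \<le> \<alpha> ^ k * (c * (\<beta> ^ k * W x))"
        using W_bounded_process(2)[OF u] discount by (intro mult_left_mono) auto
      finally show "norm (?e k) \<le> c * W x * \<gamma> ^ k" by (simp add: power_mult_distrib mult_ac)
    qed
    show "(\<lambda>k. c * W x * \<gamma> ^ k) \<longlonglongrightarrow> 0"
      using \<gamma> by (intro tendsto_mult_right_zero LIMSEQ_power_zero) auto
  qed
  from telescope_sums'[OF this]
  have "(\<lambda>k. ?e k - ?e (Suc k)) sums (\<integral>\<omega>. u (fst (\<omega> 0)) \<partial>P)" by simp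
  also have "(\<integral>\<omega>. u (fst (\<omega> 0)) \<partial>P) = (\<integral>\<omega>. u x \<partial>P)"
    using policy_measure(3)[OF \<pi> x] W_boundedD(1)[OF u]
    by (intro integral_cong_AE) (auto elim!: eventually_mono)
  also have "\<dots> = u x" by (simp add: P.prob_space)
  finally show ?thesis
    by (simp add: integral_process_Suc[OF u] algebra_simps)
qed

text \<open>The series for \<open>u x\<close> and for the discounted cost are compared term by term.
  The inequality is required along almost every trajectory, so it can come from the whole graph or
  from the graph of a single selector.\<close>

lemma policy_value_ge:
  assumes u: "W_bounded c u"
    and le: "AE \<omega> in P. \<forall>n. u (fst (\<omega> n)) \<le> cost D (\<omega> n) + \<alpha> * Qop D u (\<omega> n)"
  shows "u x \<le> policy_value D \<pi> x"
proof (rule sums_le[OF _ telescoping_process[OF u] policy_value_sums])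
  fix k
  have "(\<integral>\<omega>. u (fst (\<omega> k)) \<partial>P) \<le> (\<integral>\<omega>. on_graph (cost D) (\<omega> k) + \<alpha> * on_graph (Qop D u) (\<omega> k) \<partial>P)"
  proof (rule integral_mono_AE)
    show "AE \<omega> in P. u (fst (\<omega> k)) \<le> on_graph (cost D) (\<omega> k) + \<alpha> * on_graph (Qop D u) (\<omega> k)"
      using le policy_measure(4)[OF \<pi> x] by eventually_elim (simp add: on_graph_def)
  qed (simp_all add: W_bounded_process[OF u] cost_process_integrable Qop_process_integrable[OF u])
  also have "\<dots> = (\<integral>\<omega>. on_graph (cost D) (\<omega> k) \<partial>P) + \<alpha> * (\<integral>\<omega>. on_graph (Qop D u) (\<omega> k) \<partial>P)"
    by (simp add: cost_process_integrable Qop_process_integrable[OF u])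
  finally show "\<alpha> ^ k * ((\<integral>\<omega>. u (fst (\<omega> k)) \<partial>P) - \<alpha> * (\<integral>\<omega>. on_graph (Qop D u) (\<omega> k) \<partial>P))
      \<le> \<alpha> ^ k * (\<integral>\<omega>. on_graph (cost D) (\<omega> k) \<partial>P)"
    using discount by (intro mult_left_mono) auto
qed

lemma policy_value_le:
  assumes u: "W_bounded c u"
    and le: "AE \<omega> in P. \<forall>n. cost D (\<omega> n) + \<alpha> * Qop D u (\<omega> n) \<le> u (fst (\<omega> n))"
  shows "policy_value D \<pi> x \<le> u x"
proof (rule sums_le[OF _ policy_value_sums telescoping_process[OF u]])
  fix k
  have "(\<integral>\<omega>. on_graph (cost D) (\<omega> k) \<partial>P) + \<alpha> * (\<integral>\<omega>. on_graph (Qop D u) (\<omega> k) \<partial>P)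
      = (\<integral>\<omega>. on_graph (cost D) (\<omega> k) + \<alpha> * on_graph (Qop D u) (\<omega> k) \<partial>P)"
    by (simp add: cost_process_integrable Qop_process_integrable[OF u])
  also have "\<dots> \<le> (\<integral>\<omega>. u (fst (\<omega> k)) \<partial>P)"
  proof (rule integral_mono_AE)
    show "AE \<omega> in P. on_graph (cost D) (\<omega> k) + \<alpha> * on_graph (Qop D u) (\<omega> k) \<le> u (fst (\<omega> k))"
      using le policy_measure(4)[OF \<pi> x] by eventually_elim (simp add: on_graph_def)
  qed (simp_all add: W_bounded_process[OF u] cost_process_integrable Qop_process_integrable[OF u])
  finally show "\<alpha> ^ k * (\<integral>\<omega>. on_graph (cost D) (\<omega> k) \<partial>P)
      \<le> \<alpha> ^ k * ((\<integral>\<omega>. u (fst (\<omega> k)) \<partial>P) - \<alpha> * (\<integral>\<omega>. on_graph (Qop D u) (\<omega> k) \<partial>P))"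
    using discount by (intro mult_left_mono) auto
qed

end

lemma policy_value_lower:
  assumes \<pi>: "\<pi> \<in> policies D" and x: "x \<in> X" and u: "W_bounded c u"
    and le: "\<And>z. z \<in> G \<Longrightarrow> u (fst z) \<le> cost D z + \<alpha> * Qop D u z"
  shows "u x \<le> policy_value D \<pi> x"
proof (rule policy_value_ge[OF \<pi> x u])
  show "AE \<omega> in policy_measure D \<pi> x. \<forall>n. u (fst (\<omega> n)) \<le> cost D (\<omega> n) + \<alpha> * Qop D u (\<omega> n)"
    using policy_measure(4)[OF \<pi> x] by eventually_elim (use le in blast)
qed

section \<open>Stationary policies and their fixed point equation\<close>

text \<open>Under a stationary policy almost every pair visited has the form (y, f y) with y a
  state, so a relation checked on such pairs transfers to the trajectory.\<close>

lemma stationary_process: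
  assumes f: "f \<in> selectors D" and x: "x \<in> X"
    and Q: "\<And>y. y \<in> X \<Longrightarrow> R y (y, f y)"
  shows "AE \<omega> in policy_measure D (stationary D f) x. \<forall>n. R (fst (\<omega> n)) (\<omega> n)"
  using policy_measure(4)[OF stationary_policy[OF f] x] policy_measure(6)[OF stationary_policy[OF f] x f refl]
proof eventually_elim
  fix \<omega> assume "\<forall>k. \<omega> k \<in> G" and eq: "\<forall>k. snd (\<omega> k) = f (fst (\<omega> k))"
  then have "R (fst (\<omega> n)) (fst (\<omega> n), f (fst (\<omega> n)))" for n by (intro Q G_D) simp
  then show "\<forall>n. R (fst (\<omega> n)) (\<omega> n)" using eq by (metis prod.collapse)
qed

lemma policy_value_stationary_le:
  assumes f: "f \<in> selectors D" and x: "x \<in> X" and u: "W_bounded c u"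
    and le: "\<And>y. y \<in> X \<Longrightarrow> Tsel D f u y \<le> u y"
  shows "policy_value D (stationary D f) x \<le> u x"
  using stationary_process[OF f x, of "\<lambda>y z. cost D z + \<alpha> * Qop D u z \<le> u y"] le
  by (intro policy_value_le[OF stationary_policy[OF f] x u]) (simp add: Tsel_def)

text \<open>Uniqueness of the fixed point of T_f among \<open>W\<close>-bounded functions: whichever
  such function solves the equation is V_f. It is applied to a solution given by an explicit
  series.\<close>

lemma policy_value_stationary_eq:
  assumes f: "f \<in> selectors D" and x: "x \<in> X" and u: "W_bounded c u"
    and eq: "\<And>y. y \<in> X \<Longrightarrow> Tsel D f u y = u y"
  shows "policy_value D (stationary D f) x = u x"
proof (rule antisym)
  show "policy_value D (stationary D f) x \<le> u x"
    using eq by (intro policy_value_stationary_le[OF f x u]) simp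
  show "u x \<le> policy_value D (stationary D f) x"
    using stationary_process[OF f x, of "\<lambda>y z. u y \<le> cost D z + \<alpha> * Qop D u z"] eq
    by (intro policy_value_ge[OF stationary_policy[OF f] x u]) (simp add: Tsel_def)
qed

lemma measurable_selector_comp:
  fixes g :: "'x \<times> 'a \<Rightarrow> real"
  assumes f: "f \<in> selectors D" and g: "g \<in> borel_measurable (borel_on G)"
  shows "(\<lambda>x. g (x, f x)) \<in> borel_measurable \<X>"
proof -
  note [measurable] = selectorsD(1)[OF f]
  have "(\<lambda>x. on_graph g (x, f x)) \<in> borel_measurable \<X>"
    using on_graph_measurable[OF g] by measurable
  then show ?thesis
    using selectorsD(3)[OF f] by (subst measurable_cong[where g="\<lambda>x. on_graph g (x, f x)"]) (auto simp: space_X on_graph_def)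
qed

text \<open>The discounted sum of the iterates \<open>Q\<^sub>f\<^sup>k C\<^sub>f\<close> is an explicit fixed point of \<open>T\<^sub>f\<close>, so that
  \<open>V\<^sub>f = T\<^sub>f V\<^sub>f\<close> requires no Markov property of the trajectory measure.\<close>

primrec cost_iter :: "('x \<Rightarrow> 'a) \<Rightarrow> nat \<Rightarrow> 'x \<Rightarrow> real" where
  "cost_iter f 0 x = cost D (x, f x)"
| "cost_iter f (Suc k) x = Qop D (cost_iter f k) (x, f x)"

lemma cost_iter_bounded:
  assumes f: "f \<in> selectors D"
  shows "W_bounded (M * \<beta> ^ k) (cost_iter f k)"
proof (induction k)
  case 0
  have "(\<lambda>x. cost D (x, f x)) \<in> borel_measurable \<X>" by (rule measurable_selector_comp[OF f cost])
  then show ?case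
    using cost_bound[OF selectorsD(3)[OF f]] by (simp add: W_bounded_def)
next
  case (Suc k)
  have "(\<lambda>x. Qop D (cost_iter f k) (x, f x)) \<in> borel_measurable \<X>"
    by (intro measurable_selector_comp[OF f] Qop_measurable W_boundedD(1)[OF Suc])
  then show ?case
    using Qop_bound[OF Suc selectorsD(3)[OF f]] by (simp add: W_bounded_def mult_ac)
qed

text \<open>The constant is the sum of the M \<gamma>^k, which dominate the discounted iterates in
  the series \<open>w\<close>. Integrating \<open>w\<close> termwise and discounting shifts its
  index by one, and T_f restores the missing term of index 0. Uniqueness of the fixed point
  identifies \<open>w\<close> with V_f.\<close>

lemma stationary_value:
  assumes f: "f \<in> selectors D"
  shows "W_bounded (M / (1 - \<gamma>)) (policy_value D (stationary D f))"
    and "x \<in> X \<Longrightarrow> Tsel D f (policy_value D (stationary D f)) x = policy_value D (stationary D f) x"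
proof -
  let ?g = "\<lambda>k x. \<alpha> ^ k * cost_iter f k x"
  define w where "w x = (\<Sum>k. ?g k x)" for x
  have b: "\<bar>?g k y\<bar> \<le> M * W y * \<gamma> ^ k" if "y \<in> X" for k y
  proof -
    have "\<bar>?g k y\<bar> = \<alpha> ^ k * \<bar>cost_iter f k y\<bar>" using discount by (simp add: abs_mult)
    also have "\<dots> \<le> \<alpha> ^ k * (M * \<beta> ^ k * W y)"
      using W_boundedD(2)[OF cost_iter_bounded[OF f] that] discount by (intro mult_left_mono) auto
    finally show ?thesis by (simp add: power_mult_distrib mult_ac)
  qed
  have geo: "(\<lambda>k. M * W y * \<gamma> ^ k) sums (M * W y * (1 / (1 - \<gamma>)))" for y
    using \<gamma> by (intro sums_mult geometric_sums) auto
  have s: "summable (\<lambda>k. \<bar>?g k y\<bar>)" if "y \<in> X" for y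
    using b[OF that] by (intro summable_comparison_test'[OF sums_summable[OF geo[of y]], of 0]) auto
  have w: "W_bounded (M / (1 - \<gamma>)) w"
    unfolding W_bounded_def
  proof (intro conjI ballI)
    show "w \<in> borel_measurable \<X>"
      unfolding w_def[abs_def] using W_boundedD(1)[OF cost_iter_bounded[OF f]] by measurable
    fix y assume y: "y \<in> X"
    have "\<bar>w y\<bar> \<le> (\<Sum>k. \<bar>?g k y\<bar>)" unfolding w_def by (rule summable_rabs[OF s[OF y]])
    also have "\<dots> \<le> M * W y * (1 / (1 - \<gamma>))"
      using sums_le[OF b[OF y] summable_sums[OF s[OF y]] geo] .
    finally show "\<bar>w y\<bar> \<le> M / (1 - \<gamma>) * W y" by simp
  qed
  have fix_w: "Tsel D f w y = w y" if y: "y \<in> X" for y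
  proof -
    let ?z = "(y, f y)"
    have z: "?z \<in> G" using selectorsD(3)[OF f y] .
    have gi: "integrable (tr_kernel D ?z) (?g k)" for k
      using W_bounded_integrable[OF cost_iter_bounded[OF f] z] by simp
    have "(\<lambda>k. \<integral>t. ?g k t \<partial>tr_kernel D ?z) sums (\<integral>t. (\<Sum>k. ?g k t) \<partial>tr_kernel D ?z)"
    proof (rule sums_integral[OF gi])
      show "AE t in tr_kernel D ?z. summable (\<lambda>k. norm (?g k t))"
        using s by (intro AE_I2) (simp add: tr_kernel(3)[OF z])
      have "(\<integral>t. norm (?g k t) \<partial>tr_kernel D ?z) \<le> M * \<gamma> ^ k * Qop D W ?z" for k
      proof -
        have "(\<integral>t. norm (?g k t) \<partial>tr_kernel D ?z) \<le> (\<integral>t. M * \<gamma> ^ k * W t \<partial>tr_kernel D ?z)"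
          using b gi W_integrable[OF z] by (intro integral_mono) (auto simp: tr_kernel(3)[OF z] mult_ac)
        then show ?thesis by (simp add: Qop_def)
      qed
      then have bd: "norm (\<integral>t. norm (?g k t) \<partial>tr_kernel D ?z) \<le> M * \<gamma> ^ k * Qop D W ?z" for k
        by (simp only: real_norm_def abs_of_nonneg[OF Bochner_Integration.integral_nonneg[OF abs_ge_zero]])
      have sm: "summable (\<lambda>k. M * \<gamma> ^ k * Qop D W ?z)"
        using \<gamma> by (intro summable_mult2 summable_mult summable_geometric) simp
      show "summable (\<lambda>k. \<integral>t. norm (?g k t) \<partial>tr_kernel D ?z)"
        by (rule summable_comparison_test'[OF sm bd])
    qed
    then have "(\<lambda>k. \<alpha> * (\<alpha> ^ k * cost_iter f (Suc k) y)) sums (\<alpha> * Qop D w ?z)"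
      by (intro sums_mult) (simp add: Qop_def w_def)
    then have "(\<lambda>k. ?g (Suc k) y) sums (\<alpha> * Qop D w ?z)" by (simp add: mult.assoc)
    then have "(\<lambda>k. ?g k y) sums (\<alpha> * Qop D w ?z + ?g 0 y)" by (rule sums_Suc)
    then show ?thesis by (simp add: w_def sums_iff Tsel_def)
  qed
  have V: "policy_value D (stationary D f) y = w y" if "y \<in> X" for y
    by (rule policy_value_stationary_eq[OF f that w fix_w])
  \<comment> \<open>The identity with \<open>w\<close> holds on the state space, so measurability is
    transferred through the values there.\<close>
  show "W_bounded (M / (1 - \<gamma>)) (policy_value D (stationary D f))"
  proof -
    have "policy_value D (stationary D f) \<in> borel_measurable \<X> \<longleftrightarrow> w \<in> borel_measurable \<X>"
      by (rule measurable_cong) (simp add: V space_X)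
    then show ?thesis using w V by (simp add: W_bounded_def)
  qed
  show "Tsel D f (policy_value D (stationary D f)) x = policy_value D (stationary D f) x" if x: "x \<in> X"
    using fix_w[OF x] V x Qop_cong[OF selectorsD(3)[OF f x] V] by (simp add: Tsel_def)
qed

text \<open>With m = M / (1 - \<gamma>) one has C - \<alpha> m QW \<ge> - (M + m \<gamma>) W = - m
  W, so - m W meets the hypothesis of \<open>policy_value_lower\<close>. The bound ensures that the
  real infimum in \<open>optimal_value\<close> is taken over a set bounded below.\<close>

lemma policy_value_ge_W:
  assumes \<pi>: "\<pi> \<in> policies D" and x: "x \<in> X"
  shows "- (M / (1 - \<gamma>)) * W x \<le> policy_value D \<pi> x"
proof (rule policy_value_lower[OF \<pi> x W_bounded_scaleW])
  fix z assume z: "z \<in> G"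
  define m where "m = M / (1 - \<gamma>)"
  have m: "m * (1 - \<gamma>) = M" "0 \<le> m" using \<gamma> M_pos by (auto simp: m_def)
  have "m * \<alpha> * Qop D W z \<le> m * \<alpha> * (\<beta> * W (fst z))"
    using m discount by (intro mult_left_mono QW_bound[OF z]) auto
  moreover have "M * W (fst z) = m * (1 - \<gamma>) * W (fst z)" by (simp only: m)
  ultimately have "- m * W (fst z) \<le> cost D z + \<alpha> * (- m * Qop D W z)"
    using cost_bound[OF z] by (simp add: algebra_simps abs_le_iff)
  then show "- (M / (1 - \<gamma>)) * W (fst z) \<le> cost D z + \<alpha> * Qop D (\<lambda>x. - (M / (1 - \<gamma>)) * W x) z"
    unfolding Qop_scaleW m_def[symmetric] .
qed

lemma optimal_value_le:
  assumes "\<pi> \<in> policies D" "x \<in> X"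
  shows "optimal_value D x \<le> policy_value D \<pi> x"
  unfolding optimal_value_def
  using policy_value_ge_W assms by (intro cINF_lower bdd_belowI2) auto

lemma optimal_value_ge:
  assumes "\<And>\<pi>. \<pi> \<in> policies D \<Longrightarrow> c \<le> policy_value D \<pi> x"
  shows "c \<le> optimal_value D x"
  unfolding optimal_value_def
  using assms stationary_policy[OF f0] by (intro cINF_greatest) auto

end

section \<open>Lower semicontinuity\<close>

text \<open>The punctured neighbourhood in \<open>at z within S\<close> may be filled in, since the
  centre itself satisfies the strict inequality. The open-set form is the one used for
  measurability, scaling and the compactness argument.\<close>

lemma lower_semicontinuous_on_iff_openin:
  "lower_semicontinuous_on S g \<longleftrightarrow> (\<forall>c. openin (top_of_set S) {x\<in>S. c < g x})"
proof
  assume g: "lower_semicontinuous_on S g"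
  show "\<forall>c. openin (top_of_set S) {x\<in>S. c < g x}"
  proof
    fix c
    show "openin (top_of_set S) {x\<in>S. c < g x}"
    proof (subst openin_subopen, rule ballI)
      fix x assume x: "x \<in> {x\<in>S. c < g x}"
      then have "eventually (\<lambda>y. c < g y) (at x within S)"
        using g by (auto simp: lower_semicontinuous_on_def)
      then obtain T where T: "open T" "x \<in> T" "\<And>y. y \<in> T \<Longrightarrow> y \<noteq> x \<Longrightarrow> y \<in> S \<Longrightarrow> c < g y"
        unfolding eventually_at_topological by blast
      then show "\<exists>U. openin (top_of_set S) U \<and> x \<in> U \<and> U \<subseteq> {x\<in>S. c < g x}"
        using x by (intro exI[of _ "S \<inter> T"]) (auto simp: openin_open_Int)
    qed
  qed
next
  assume *: "\<forall>c. openin (top_of_set S) {x\<in>S. c < g x}"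
  show "lower_semicontinuous_on S g"
    unfolding lower_semicontinuous_on_def
  proof (intro ballI allI impI)
    fix x c assume x: "x \<in> S" "c < g x"
    from * obtain T where T: "open T" "{x\<in>S. c < g x} = S \<inter> T"
      unfolding openin_open by blast
    then show "eventually (\<lambda>y. c < g y) (at x within S)"
      unfolding eventually_at_topological using x by (intro exI[of _ T]) blast
  qed
qed

lemma lower_semicontinuous_on_ex_ball:
  fixes S :: "'z::metric_space set"
  assumes "lower_semicontinuous_on S g" "x \<in> S" "c < g x"
  obtains r where "0 < r" "\<And>y. y \<in> S \<Longrightarrow> dist x y < r \<Longrightarrow> c < g y"
proof -
  have "openin (top_of_set S) {x\<in>S. c < g x}" and "x \<in> {x\<in>S. c < g x}"
    using assms by (auto simp: lower_semicontinuous_on_iff_openin)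
  then show ?thesis
    using that by (auto simp: openin_euclidean_subtopology_iff dist_commute)
qed

lemma lower_semicontinuous_on_measurable:
  fixes S :: "'z::topological_space set" and g :: "'z \<Rightarrow> real"
  assumes "lower_semicontinuous_on S g"
  shows "g \<in> borel_measurable (restrict_space borel S)"
proof (rule borel_measurableI_greater)
  fix c
  have "openin (top_of_set S) {x\<in>S. c < g x}" using assms by (simp add: lower_semicontinuous_on_iff_openin)
  then obtain T where "open T" "{x\<in>S. c < g x} = S \<inter> T" unfolding openin_open by blast
  then show "{x \<in> space (restrict_space borel S). c < g x} \<in> sets (restrict_space borel S)"
    by (auto simp: space_restrict_space sets_restrict_space)
qed

lemma continuous_imp_lower_semicontinuous_on:
  "continuous_on S g \<Longrightarrow> lower_semicontinuous_on S g"
  by (auto simp: lower_semicontinuous_on_def continuous_on_def dest: order_tendstoD(1))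

lemma lower_semicontinuous_on_add:
  assumes f: "lower_semicontinuous_on S f" and g: "lower_semicontinuous_on S g"
  shows "lower_semicontinuous_on S (\<lambda>x. f x + g x)"
  unfolding lower_semicontinuous_on_def
proof (intro ballI allI impI)
  fix z c assume z: "z \<in> S" and c: "c < f z + g z"
  define d where "d = (f z + g z - c) / 2"
  have "f z - d < f z" "g z - d < g z" using c by (auto simp: d_def)
  then have "eventually (\<lambda>w. f z - d < f w) (at z within S)" "eventually (\<lambda>w. g z - d < g w) (at z within S)"
    using f g z unfolding lower_semicontinuous_on_def by blast+
  then show "eventually (\<lambda>w. c < f w + g w) (at z within S)"
  proof eventually_elim
    fix w assume "f z - d < f w" "g z - d < g w"
    moreover have "f z - d + (g z - d) = c" by (simp add: d_def field_simps)
    ultimately show "c < f w + g w" by linarith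
  qed
qed

lemma lower_semicontinuous_on_cmult:
  assumes a: "0 < (a::real)" and f: "lower_semicontinuous_on S f"
  shows "lower_semicontinuous_on S (\<lambda>x. a * f x)"
proof -
  have "{x\<in>S. c < a * f x} = {x\<in>S. c / a < f x}" for c
    using a by (auto simp: field_simps)
  then show ?thesis using f by (simp add: lower_semicontinuous_on_iff_openin)
qed

text \<open>A tube argument. A superlevel set of \<open>k\<close> is relatively open in the graph
  and contains {x} times F x. Compactness gives a product neighbourhood U times V inside it, and
  upper semicontinuity keeps F y in V for y near x.\<close>

lemma lower_semicontinuous_on_INF:
  fixes F :: "'x::topological_space \<Rightarrow> 'a::topological_space set" and k :: "'x \<times> 'a \<Rightarrow> real"
  assumes F: "upper_semicontinuous_multifunction X A F"
    and sub: "\<And>x. x \<in> X \<Longrightarrow> F x \<subseteq> A" and comp: "\<And>x. x \<in> X \<Longrightarrow> compact (F x)"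
    and ne: "\<And>x. x \<in> X \<Longrightarrow> F x \<noteq> {}"
    and k: "lower_semicontinuous_on (Sigma X F) k"
    and bdd: "\<And>x. x \<in> X \<Longrightarrow> bdd_below ((\<lambda>a. k (x, a)) ` F x)"
  shows "lower_semicontinuous_on X (\<lambda>x. INF a\<in>F x. k (x, a))"
  unfolding lower_semicontinuous_on_iff_openin
proof (intro allI, subst openin_subopen, rule ballI)
  fix c x assume "x \<in> {x\<in>X. c < (INF a\<in>F x. k (x, a))}"
  then have x: "x \<in> X" and c: "c < (INF a\<in>F x. k (x, a))" by auto
  \<comment> \<open>Pointwise strict inequalities yield only a weak one for the infimum over
    \<open>F y\<close>; the level \<open>d\<close> strictly above \<open>c\<close> makes up for
    this.\<close>
  obtain d where d: "c < d" "d < (INF a\<in>F x. k (x, a))" using dense[OF c] by blast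
  have "openin (top_of_set (Sigma X F)) {z\<in>Sigma X F. d < k z}"
    using k by (simp add: lower_semicontinuous_on_iff_openin)
  then obtain T where T: "open T" "{z\<in>Sigma X F. d < k z} = Sigma X F \<inter> T" unfolding openin_open by blast
  have "d < k (x, a)" if "a \<in> F x" for a
    using d(2) cINF_lower[OF bdd[OF x] that] by linarith
  then have xT: "{x} \<times> F x \<subseteq> T" using T(2) x by auto
  have "openin (prod_topology euclidean euclidean) T"
    using T(1) unfolding openin_prod_topology_alt open_prod_def by (fastforce simp: open_openin[symmetric] mem_Times_iff)
  from Wallace_theorem_prod_topology[OF _ _ this xT] obtain U V
    where UV: "open U" "open V" "x \<in> U" "F x \<subseteq> V" "U \<times> V \<subseteq> T"
    using comp[OF x] by (auto simp: open_openin[symmetric])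
  let ?N = "{y\<in>X. F y \<subseteq> A \<inter> V} \<inter> (X \<inter> U)"
  have "openin (top_of_set X) {y\<in>X. F y \<subseteq> A \<inter> V}"
    using F openin_open_Int[OF UV(2), of A] unfolding upper_semicontinuous_multifunction_def by blast
  then have "openin (top_of_set X) ?N"
    by (rule openin_Int[OF _ openin_open_Int[OF UV(1)]])
  moreover have "x \<in> ?N" using x UV sub by auto
  moreover have "?N \<subseteq> {x\<in>X. c < (INF a\<in>F x. k (x, a))}"
  proof
    fix y assume y: "y \<in> ?N"
    have "d \<le> (INF a\<in>F y. k (y, a))"
    proof (rule cINF_greatest)
      show "F y \<noteq> {}" using ne y by auto
      fix a assume a: "a \<in> F y"
      then have "(y, a) \<in> Sigma X F \<inter> T" using y UV(5) by auto
      then show "d \<le> k (y, a)" unfolding T(2)[symmetric] by auto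
    qed
    then show "y \<in> {x\<in>X. c < (INF a\<in>F x. k (x, a))}" using y d(1) by auto
  qed
  ultimately show "\<exists>U. openin (top_of_set X) U \<and> x \<in> U \<and> U \<subseteq> {x\<in>X. c < (INF a\<in>F x. k (x, a))}" by blast
qed

section \<open>The lower semicontinuous envelope\<close>

text \<open>The minorant \<open>l\<close> serves twice: it keeps the extended supremum away from
  minus infinity, so \<open>real_of_ereal\<close> loses nothing, and its arbitrariness expresses
  that the envelope is maximal among lower semicontinuous minorants. Around \<open>x\<close> there
  is a ball on which \<open>l\<close> exceeds any prescribed level below \<open>l x\<close>.\<close>

lemma lsc_envelope_bounds:
  fixes X :: "'x::metric_space set"
  assumes l: "lower_semicontinuous_on X l" and le: "\<And>y. y \<in> X \<Longrightarrow> l y \<le> u y" and x: "x \<in> X"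
  shows "ereal (lsc_envelope X u x) = (SUP r\<in>{0<..}. INF y\<in>ball x r \<inter> X. ereal (u y))" (is "_ = ?E")
    and "l x \<le> lsc_envelope X u x" and "lsc_envelope X u x \<le> u x"
proof -
  have upper: "?E \<le> ereal (u x)"
    using x by (intro SUP_least INF_lower2[of x]) auto
  have lower: "ereal (l x) \<le> ?E"
  proof (rule dense_le)
    fix e assume e: "e < ereal (l x)"
    show "e \<le> ?E"
    proof (cases e)
      case (real c)
      with e obtain r where r: "0 < r" "\<And>y. y \<in> X \<Longrightarrow> dist x y < r \<Longrightarrow> c < l y"
        using lower_semicontinuous_on_ex_ball[OF l x, of c] by auto
      have "e \<le> (INF y\<in>ball x r \<inter> X. ereal (u y))"
      proof (rule INF_greatest)
        fix y assume "y \<in> ball x r \<inter> X"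
        then show "e \<le> ereal (u y)" using r(2)[of y] le[of y] real by simp
      qed
      then show ?thesis using r(1) by (intro SUP_upper2[of r]) auto
    qed (use e in auto)
  qed
  show eq: "ereal (lsc_envelope X u x) = ?E"
    using upper lower unfolding lsc_envelope_def by (cases ?E) auto
  show "l x \<le> lsc_envelope X u x" "lsc_envelope X u x \<le> u x"
    using upper lower unfolding eq[symmetric] by simp_all
qed

text \<open>If the infimum over the ball of radius r at x exceeds c, so does the one over the ball
  of radius r/2 at any y within r/2 of x, because the smaller ball is contained in the
  larger.\<close>

lemma lower_semicontinuous_on_lsc_envelope:
  fixes X :: "'x::metric_space set"
  assumes l: "lower_semicontinuous_on X l" and le: "\<And>y. y \<in> X \<Longrightarrow> l y \<le> u y"
  shows "lower_semicontinuous_on X (lsc_envelope X u)"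
  unfolding lower_semicontinuous_on_def
proof (intro ballI allI impI)
  fix x c assume x: "x \<in> X" and "c < lsc_envelope X u x"
  then have "ereal c < (SUP r\<in>{0<..}. INF y\<in>ball x r \<inter> X. ereal (u y))"
    using lsc_envelope_bounds(1)[OF l le x] by (metis less_ereal.simps(1))
  then obtain r where r: "0 < r" "ereal c < (INF y\<in>ball x r \<inter> X. ereal (u y))"
    unfolding less_SUP_iff by auto
  show "eventually (\<lambda>y. c < lsc_envelope X u y) (at x within X)"
    unfolding eventually_at
  proof (intro exI[of _ "r / 2"] conjI ballI impI)
    fix y assume y: "y \<in> X" "y \<noteq> x \<and> dist y x < r / 2"
    have "ball y (r / 2) \<subseteq> ball x r"
    proof
      fix t assume "t \<in> ball y (r / 2)"
      then have "dist y t < r / 2" by simp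
      then show "t \<in> ball x r" using y dist_triangle[of x t y] by (simp add: dist_commute)
    qed
    then have "(INF y\<in>ball x r \<inter> X. ereal (u y)) \<le> (INF y\<in>ball y (r / 2) \<inter> X. ereal (u y))"
      by (intro INF_superset_mono) auto
    also have "\<dots> \<le> (SUP r\<in>{0<..}. INF t\<in>ball y r \<inter> X. ereal (u t))"
      using r(1) by (intro SUP_upper) auto
    also have "\<dots> = ereal (lsc_envelope X u y)"
      by (rule lsc_envelope_bounds(1)[OF l le y(1), symmetric])
    finally have "ereal c < ereal (lsc_envelope X u y)" using r(2) by (rule order_less_le_trans[rotated])
    then show "c < lsc_envelope X u y" by simp
  qed (use r in auto)
qed

text \<open>The approximants are truncated inf-convolutions \<open>min k (INF y. g y + k * dist x y)\<close>.\<close>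

lemma lower_semicontinuous_on_approx:
  fixes X :: "'x::metric_space set" and g :: "'x \<Rightarrow> real"
  assumes g: "lower_semicontinuous_on X g" and nonneg: "\<And>x. x \<in> X \<Longrightarrow> 0 \<le> g x"
  obtains h :: "nat \<Rightarrow> 'x \<Rightarrow> real"
  where "\<And>k. continuous_on X (h k)" "\<And>k. bounded (h k ` X)"
    "\<And>k x. x \<in> X \<Longrightarrow> 0 \<le> h k x" "\<And>k x. x \<in> X \<Longrightarrow> h k x \<le> g x"
    "\<And>x. x \<in> X \<Longrightarrow> (\<lambda>k. h k x) \<longlonglongrightarrow> g x"
proof
  define I where "I k x = (INF y\<in>X. g y + real k * dist x y)" for k x
  define h where "h k x = min (real k) (I k x)" for k x
  have bdd: "bdd_below ((\<lambda>y. g y + real k * dist x y) ` X)" for k x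
    using nonneg by (intro bdd_belowI2[of _ 0]) auto
  have I_le: "I k x \<le> g y + real k * dist x y" if "y \<in> X" for k x y
    unfolding I_def by (rule cINF_lower[OF bdd that])
  \<comment> \<open>Each competitor in the infimum is \<open>k\<close>-Lipschitz in
    \<open>x\<close>, and so is the infimum.\<close>
  have I_lip: "I k x - I k x' \<le> real k * dist x x'" if "x' \<in> X" for k x x'
  proof -
    have "I k x - real k * dist x x' \<le> I k x'"
      unfolding I_def[of k x']
    proof (rule cINF_greatest)
      fix y assume y: "y \<in> X"
      have "real k * dist x y \<le> real k * (dist x x' + dist x' y)"
        by (intro mult_left_mono dist_triangle) auto
      then show "I k x - real k * dist x x' \<le> g y + real k * dist x' y"
        using I_le[OF y, of k x] by (simp add: distrib_left)
    qed (use that in auto)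
    then show ?thesis by simp
  qed
  have I_nonneg: "0 \<le> I k x" if "x \<in> X" for k x
    unfolding I_def using that nonneg by (intro cINF_greatest) auto
  show "continuous_on X (h k)" for k
  proof -
    have "(real k)-lipschitz_on X (I k)"
    proof (rule lipschitz_onI)
      fix x y assume "x \<in> X" "y \<in> X"
      then show "dist (I k x) (I k y) \<le> real k * dist x y"
        using I_lip[of y k x] I_lip[of x k y] by (simp add: dist_real_def dist_commute abs_le_iff)
    qed simp
    then show ?thesis
      unfolding h_def[abs_def] by (intro continuous_on_min continuous_on_const lipschitz_on_continuous_on)
  qed
  show h0: "0 \<le> h k x" if "x \<in> X" for k x
    using I_nonneg[OF that] by (simp add: h_def)
  show "bounded (h k ` X)" for k
    using h0 by (intro boundedI[of _ "real k"]) (auto simp: h_def)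
  show hg: "h k x \<le> g x" if "x \<in> X" for k x
    using I_le[OF that, of k x] by (simp add: h_def)
  show "(\<lambda>k. h k x) \<longlonglongrightarrow> g x" if x: "x \<in> X" for x
  proof (rule order_tendstoI)
    fix c assume "g x < c"
    then show "eventually (\<lambda>k. h k x < c) sequentially"
      using hg[OF x] by (intro always_eventually allI) (rule le_less_trans)
  next
    fix c assume "c < g x"
    then obtain d where d: "c < d" "d < g x" using dense by blast
    obtain r where r: "0 < r" "\<And>y. y \<in> X \<Longrightarrow> dist x y < r \<Longrightarrow> d < g y"
      using lower_semicontinuous_on_ex_ball[OF g x d(2)] by blast
    \<comment> \<open>Points closer than \<open>r\<close> have \<open>g\<close> above
      \<open>d\<close>, points farther away pay a penalty of at least k r \<ge> d, and the
      truncation level is itself at least \<open>d\<close>.\<close>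
    have "eventually (\<lambda>k. max d (d / r) \<le> real k) sequentially"
      using eventually_ge_at_top[of "nat \<lceil>max d (d / r)\<rceil>"] by eventually_elim linarith
    then show "eventually (\<lambda>k. c < h k x) sequentially"
    proof eventually_elim
      fix k assume k: "max d (d / r) \<le> real k"
      have "d \<le> I k x"
        unfolding I_def
      proof (rule cINF_greatest)
        fix y assume y: "y \<in> X"
        show "d \<le> g y + real k * dist x y"
        proof (cases "dist x y < r")
          case True
          have "d \<le> g y" "0 \<le> real k * dist x y" using r(2)[OF y True] by auto
          then show ?thesis by linarith
        next
          case False
          have "d \<le> real k * r" using k r(1) by (simp add: field_simps)
          also have "\<dots> \<le> real k * dist x y" using False by (intro mult_left_mono) auto
          finally show ?thesis using nonneg[OF y] by linarith
        qed
      qed (use x in auto)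
      then show "c < h k x" using k d(1) by (simp add: h_def)
    qed
  qed
qed


section \<open>Policy iteration\<close>

locale continuous_model = growth_model D f0 M \<beta> W
  for D :: "('x::polish_space, 'a::polish_space) mdm" and f0 M \<beta> W +
  assumes cc: "compactness_continuity_conditions D W"
begin

lemma W_cont: "continuous_on X W" and QW_cont: "continuous_on G (Qop D W)"
  and cost_lsc: "lower_semicontinuous_on G (cost D)"
  and weakly_continuous: "continuous_on X u \<Longrightarrow> bounded (u ` X) \<Longrightarrow> continuous_on G (Qop D u)"
  and adm_compact: "x \<in> X \<Longrightarrow> compact (adm D x)"
  and adm_usc: "upper_semicontinuous_multifunction X A (adm D)"
  using cc by (auto simp: compactness_continuity_conditions_def weakly_continuous_kernel_def)

lemma Qop_tendsto:
  assumes h: "\<And>k. h k \<in> borel_measurable \<X>" and g: "W_bounded c g"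
    and le: "\<And>k x. x \<in> X \<Longrightarrow> \<bar>h k x\<bar> \<le> d * W x"
    and lim: "\<And>x. x \<in> X \<Longrightarrow> (\<lambda>k. h k x) \<longlonglongrightarrow> g x" and z: "z \<in> G"
  shows "(\<lambda>k. Qop D (h k) z) \<longlonglongrightarrow> Qop D g z"
  unfolding Qop_def
proof (rule integral_dominated_convergence[where w="\<lambda>x. d * W x"])
  show "g \<in> borel_measurable (tr_kernel D z)" "h k \<in> borel_measurable (tr_kernel D z)" for k
    using h W_boundedD(1)[OF g] by (simp_all cong: measurable_cong_sets add: tr_kernel(2)[OF z])
  show "integrable (tr_kernel D z) (\<lambda>x. d * W x)" using W_integrable[OF z] by simp
qed (use le lim in \<open>auto simp: tr_kernel(3)[OF z]\<close>)

text \<open>Dominated convergence picks one bounded continuous minorant whose integral at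
  \<open>z\<close> already exceeds \<open>e\<close>; weak continuity preserves this near
  \<open>z\<close>, and monotonicity passes it on to \<open>g\<close>.\<close>

lemma Qop_lsc_nonneg:
  assumes g: "W_bounded c g" and lsc: "lower_semicontinuous_on X g" and nonneg: "\<And>x. x \<in> X \<Longrightarrow> 0 \<le> g x"
  shows "lower_semicontinuous_on G (Qop D g)"
  unfolding lower_semicontinuous_on_def
proof (intro ballI allI impI)
  fix z e assume z: "z \<in> G" and e: "e < Qop D g z"
  obtain h where cont: "\<And>k. continuous_on X (h k)" and bd: "\<And>k::nat. bounded (h k ` X)"
    and h: "\<And>k x. x \<in> X \<Longrightarrow> 0 \<le> h k x" "\<And>k x. x \<in> X \<Longrightarrow> h k x \<le> g x"
      "\<And>x. x \<in> X \<Longrightarrow> (\<lambda>k. h k x) \<longlonglongrightarrow> g x"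
    using lower_semicontinuous_on_approx[OF lsc nonneg] by blast
  have m: "h k \<in> borel_measurable \<X>" for k
    by (rule borel_measurable_continuous_on_restrict[OF cont])
  have b: "\<bar>h k x\<bar> \<le> c * W x" if "x \<in> X" for k x
    using h(1,2)[OF that, of k] W_boundedD(2)[OF g that] by linarith
  have hb: "W_bounded c (h k)" for k using m b by (simp add: W_bounded_def)
  have "(\<lambda>k. Qop D (h k) z) \<longlonglongrightarrow> Qop D g z"
    by (rule Qop_tendsto[OF m g b h(3) z])
  from order_tendstoD(1)[OF this e] obtain k where k: "e < Qop D (h k) z"
    using eventually_happens by force
  have "(Qop D (h k) \<longlongrightarrow> Qop D (h k) z) (at z within G)"
    using weakly_continuous[OF cont bd] z by (auto simp: continuous_on_def)
  from order_tendstoD(1)[OF this k]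
  have "eventually (\<lambda>w. e < Qop D (h k) w) (at z within G)" .
  moreover have "eventually (\<lambda>w. w \<in> G) (at z within G)"
    by (auto simp: eventually_at_filter)
  ultimately show "eventually (\<lambda>w. e < Qop D g w) (at z within G)"
  proof eventually_elim
    fix w assume "e < Qop D (h k) w" "w \<in> G"
    then show "e < Qop D g w" using Qop_mono[OF hb g _ h(2)] by (meson less_le_trans)
  qed
qed

text \<open>Adding c W makes \<open>u\<close> nonnegative and keeps it lower semicontinuous, because
  \<open>W\<close> is continuous. Subtracting c QW afterwards keeps the integral lower
  semicontinuous, because QW is continuous.\<close>

lemma Qop_lsc:
  assumes u: "W_bounded c u" and lsc: "lower_semicontinuous_on X u"
  shows "lower_semicontinuous_on G (Qop D u)"
proof -
  have v: "W_bounded \<bar>c\<bar> (\<lambda>x. c * W x)" by (rule W_bounded_scaleW)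
  have w: "W_bounded (c + c) (\<lambda>x. u x + c * W x)"
    using W_boundedD[OF u] W_nonneg W_bounded_nonneg[OF u]
    by (fastforce simp: W_bounded_def distrib_right)
  have "lower_semicontinuous_on X (\<lambda>x. u x + c * W x)"
    by (intro lower_semicontinuous_on_add lsc continuous_imp_lower_semicontinuous_on continuous_intros W_cont)
  then have "lower_semicontinuous_on G (Qop D (\<lambda>x. u x + c * W x))"
  proof (rule Qop_lsc_nonneg[OF w])
    fix x assume "x \<in> X"
    then show "0 \<le> u x + c * W x" using W_boundedD(2)[OF u, of x] by linarith
  qed
  moreover have "lower_semicontinuous_on G (\<lambda>z. - c * Qop D W z)"
    by (intro continuous_imp_lower_semicontinuous_on continuous_intros QW_cont)
  ultimately have "lower_semicontinuous_on G (\<lambda>z. Qop D (\<lambda>x. u x + c * W x) z + - c * Qop D W z)"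
    by (rule lower_semicontinuous_on_add)
  moreover have "Qop D (\<lambda>x. u x + c * W x) z + - c * Qop D W z = Qop D u z" if "z \<in> G" for z
    using Bochner_Integration.integral_add[OF W_bounded_integrable[OF u that] W_bounded_integrable[OF v that]]
    by (simp add: Qop_def)
  ultimately show ?thesis
    by (simp add: lower_semicontinuous_on_iff_openin cong: conj_cong)
qed

text \<open>A real \<open>INF\<close> is a genuine infimum only over a set bounded below; the growth
  bounds on the cost and on QW provide this.\<close>

lemma Top_bdd_below:
  assumes u: "W_bounded c u" and x: "x \<in> X"
  shows "bdd_below ((\<lambda>a. cost D (x, a) + \<alpha> * Qop D u (x, a)) ` adm D x)"
proof (rule bdd_belowI2)
  fix a assume "a \<in> adm D x"
  then have z: "(x, a) \<in> G" using GI[OF x] by simp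
  have "\<alpha> * (- (c * \<beta> * W x)) \<le> \<alpha> * Qop D u (x, a)"
    using Qop_bound[OF u z] discount by (intro mult_left_mono) auto
  then show "- (M * W x) + \<alpha> * (- (c * \<beta> * W x)) \<le> cost D (x, a) + \<alpha> * Qop D u (x, a)"
    using cost_bound[OF z] by simp
qed

lemma Top_le:
  assumes u: "W_bounded c u" and z: "z \<in> G"
  shows "Top D u (fst z) \<le> cost D z + \<alpha> * Qop D u z"
  using cINF_lower[OF Top_bdd_below[OF u G_D(1)[OF z]] G_D(2)[OF z]] by (simp add: Top_def)

lemma Top_lsc:
  assumes u: "W_bounded c u" and lsc: "lower_semicontinuous_on X u"
  shows "lower_semicontinuous_on X (Top D u)"
proof -
  have sub: "adm D x \<subseteq> A" if "x \<in> X" for x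
    using G_D(3)[OF GI[OF that]] by auto
  have "lower_semicontinuous_on G (\<lambda>z. cost D z + \<alpha> * Qop D u z)"
    using discount by (intro lower_semicontinuous_on_add cost_lsc lower_semicontinuous_on_cmult Qop_lsc[OF u lsc])
  then have "lower_semicontinuous_on X (\<lambda>x. INF a\<in>adm D x. cost D (x, a) + \<alpha> * Qop D u (x, a))"
    using lower_semicontinuous_on_INF[OF adm_usc, of "\<lambda>z. cost D z + \<alpha> * Qop D u z"]
      adm_compact adm_nonempty Top_bdd_below[OF u] sub by (simp add: graph_def)
  then show ?thesis by (simp add: Top_def[abs_def])
qed

text \<open>The continuous function - c W is a lower semicontinuous minorant of \<open>u\<close>, so
  the envelope lies between - c W and \<open>u\<close> and keeps the constant \<open>c\<close>. Its
  lower semicontinuity gives measurability.\<close>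

lemma envelope_W_bounded:
  assumes u: "W_bounded c u"
  shows "W_bounded c (lsc_envelope X u)" "lower_semicontinuous_on X (lsc_envelope X u)"
proof -
  have l: "lower_semicontinuous_on X (\<lambda>x. - c * W x)"
    by (intro continuous_imp_lower_semicontinuous_on continuous_intros W_cont)
  have le: "- c * W x \<le> u x" "u x \<le> c * W x" if "x \<in> X" for x
    using W_boundedD(2)[OF u that] by (auto simp: abs_le_iff)
  show lsc: "lower_semicontinuous_on X (lsc_envelope X u)"
    by (rule lower_semicontinuous_on_lsc_envelope[OF l le(1)])
  show "W_bounded c (lsc_envelope X u)"
    unfolding W_bounded_def
    using lower_semicontinuous_on_measurable[OF lsc] lsc_envelope_bounds(2,3)[OF l le(1)] le
    by (force simp: abs_le_iff)
qed

lemma envelope_le: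
  assumes u: "W_bounded c u" and x: "x \<in> X"
  shows "lsc_envelope X u x \<le> u x"
proof -
  have "lower_semicontinuous_on X (\<lambda>x. - c * W x)"
    by (intro continuous_imp_lower_semicontinuous_on continuous_intros W_cont)
  then show ?thesis
  proof (rule lsc_envelope_bounds(3)[OF _ _ x])
    fix y assume "y \<in> X"
    then show "- c * W y \<le> u y" using W_boundedD(2)[OF u, of y] by linarith
  qed
qed

section \<open>Monotone improvement and comparison with the optimal value\<close>

text \<open>The envelope is a supersolution for the new selector: \<open>g\<close> attains the
  infimum that defines T e, so T_g e = T e \<le> e.\<close>

lemma improvement_step:
  fixes f g
  defines "v \<equiv> policy_value D (stationary D f)" and "v' \<equiv> policy_value D (stationary D g)"
  defines "e \<equiv> lsc_envelope X v"
  assumes f: "f \<in> selectors D" and g: "g \<in> selectors D"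
    and sel: "\<And>x. x \<in> X \<Longrightarrow> Top D e x = Tsel D g e x" and x: "x \<in> X"
  shows "e x \<le> v x" and "Top D e x \<le> e x" and "v' x \<le> Top D e x"
proof -
  note v = stationary_value[OF f, folded v_def]
  note v' = stationary_value[OF g, folded v'_def]
  note e = envelope_W_bounded[OF v(1), folded e_def]
  note e_le = envelope_le[OF v(1), folded e_def]
  show "e x \<le> v x" by (rule e_le[OF x])
  have Tv: "Top D e y \<le> v y" if y: "y \<in> X" for y
  proof -
    have z: "(y, f y) \<in> G" by (rule selectorsD(3)[OF f y])
    have "Top D e y \<le> cost D (y, f y) + \<alpha> * Qop D e (y, f y)"
      using Top_le[OF e(1) z] by simp
    also have "\<dots> \<le> cost D (y, f y) + \<alpha> * Qop D v (y, f y)"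
      using Qop_mono[OF e(1) v(1) z e_le] discount by simp
    also have "\<dots> = v y" using v(2)[OF y] by (simp add: Tsel_def)
    finally show ?thesis .
  qed
  have Te: "Top D e y \<le> e y" if y: "y \<in> X" for y
    unfolding e_def by (rule lsc_envelope_bounds(2)[OF Top_lsc[OF e] Tv y, unfolded e_def])
  show "Top D e x \<le> e x" by (rule Te[OF x])
  have v'_e: "v' y \<le> e y" if "y \<in> X" for y
    unfolding v'_def using Te sel by (intro policy_value_stationary_le[OF g that e(1)]) simp
  \<comment> \<open>Inserting v' \<le> e once into the equation v' = T_g v' sharpens the bound to v'
    \<le> T e.\<close>
  have "v' x = cost D (x, g x) + \<alpha> * Qop D v' (x, g x)"
    using v'(2)[OF x] by (simp add: Tsel_def)
  also have "\<dots> \<le> cost D (x, g x) + \<alpha> * Qop D e (x, g x)"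
    using Qop_mono[OF v'(1) e(1) selectorsD(3)[OF g x] v'_e] discount by simp
  also have "\<dots> = Top D e x" using sel[OF x] by (simp add: Tsel_def)
  finally show "v' x \<le> Top D e x" .
qed

text \<open>A subsolution on the whole graph lies below the cost of every policy. This criterion
  settles both the stopping test and the limit of the iteration.\<close>

lemma le_optimal_value:
  assumes u: "W_bounded c u" and le: "\<And>z. z \<in> G \<Longrightarrow> u (fst z) \<le> cost D z + \<alpha> * Qop D u z" and x: "x \<in> X"
  shows "u x \<le> optimal_value D x"
  using policy_value_lower[OF _ x u le] by (rule optimal_value_ge)

end

theorem theorem4p2:
  fixes D :: "('x::polish_space, 'a::polish_space) mdm"
    and M \<beta> :: real and W :: "'x \<Rightarrow> real"
    and f0 :: "'x \<Rightarrow> 'a"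
    and f :: "nat \<Rightarrow> 'x \<Rightarrow> 'a" and v ve :: "nat \<Rightarrow> 'x \<Rightarrow> real"
  assumes "markov_decision_model D"
    and "growth_conditions D M \<beta> W"
    and "compactness_continuity_conditions D W"
    and "f0 \<in> selectors D" and "f 0 = f0"
    and "policy_iteration D f v"
    and "\<And>n. ve n = lsc_envelope (states D) (v n)"
  shows "(\<forall>n. \<forall>x\<in>states D. v n x \<ge> ve n x \<and> ve n x \<ge> Top D (ve n) x \<and>
             Top D (ve n) x \<ge> v (Suc n) x \<and> v (Suc n) x \<ge> ve (Suc n) x) \<and>
         (\<forall>n. (\<forall>x\<in>states D. ve n x = v (Suc n) x) \<longrightarrow>
             (\<forall>x\<in>states D. ve n x = optimal_value D x) \<and>
             optimal_policy D (stationary D (f (Suc n)))) \<and>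
         (\<forall>x\<in>states D. (\<lambda>n. v n x) \<longlonglongrightarrow> optimal_value D x \<and>
             (\<lambda>n. ve n x) \<longlonglongrightarrow> optimal_value D x \<and>
             (\<lambda>n. Top D (ve n) x) \<longlonglongrightarrow> optimal_value D x)"
proof -
  have "continuous_on (states D) W" using assms(3) by (simp add: compactness_continuity_conditions_def)
  then interpret continuous_model D f0 M \<beta> W
    using assms(1-4)
    by (intro continuous_model.intro growth_model.intro decision_model.intro growth_model_axioms.intro
        continuous_model_axioms.intro borel_measurable_continuous_on_restrict)
  have f: "f n \<in> selectors D" for n
    using assms(4-6) by (cases n) (auto simp: policy_iteration_def)
  have v: "v n = policy_value D (stationary D (f n))" for n
    using assms(6) by (simp add: policy_iteration_def)
  have sel: "Top D (ve n) x = Tsel D (f (Suc n)) (ve n) x" if "x \<in> X" for n x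
    using assms(6) that unfolding policy_iteration_def assms(7) by blast
  \<comment> \<open>One constant bounds every \<open>v n\<close> and every envelope, as dominated
    convergence along the iteration demands.\<close>
  define c where "c = M / (1 - \<gamma>)"
  have vb: "W_bounded c (v n)" for n
    unfolding v c_def by (rule stationary_value(1)[OF f])
  have eb: "W_bounded c (ve n)" for n
    unfolding assms(7) by (rule envelope_W_bounded(1)[OF vb])
  have a1: "ve n x \<le> v n x" and a2: "Top D (ve n) x \<le> ve n x" and a3: "v (Suc n) x \<le> Top D (ve n) x"
    if "x \<in> X" for n x
    using improvement_step[OF f[of n] f[of "Suc n"], folded v, folded assms(7), OF sel that] by auto
  have opt_v: "optimal_value D x \<le> v n x" if "x \<in> X" for n x
    unfolding v by (rule optimal_value_le[OF stationary_policy[OF f] that])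
  have b: "(\<forall>x\<in>X. ve n x = optimal_value D x) \<and> optimal_policy D (stationary D (f (Suc n)))"
    if eq: "\<forall>x\<in>X. ve n x = v (Suc n) x" for n
  proof -
    \<comment> \<open>When the iteration stops, ve n = v (n+1) \<le> T (ve n) by \<open>a3\<close>,
      so \<open>ve n\<close> is a subsolution. The converse bound will hold because v (n+1) is the
      cost of a policy.\<close>
    have "ve n x \<le> optimal_value D x" if x: "x \<in> X" for x
    proof (rule le_optimal_value[OF eb _ x])
      fix z assume z: "z \<in> G"
      show "ve n (fst z) \<le> cost D z + \<alpha> * Qop D (ve n) z"
        using eq a3[OF G_D(1)[OF z], of n] Top_le[OF eb[of n] z] G_D(1)[OF z] by auto
    qed
    then have "\<forall>x\<in>X. ve n x = optimal_value D x"
      using opt_v[of _ "Suc n"] eq by (intro ballI antisym) auto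
    then show ?thesis
      using eq stationary_policy[OF f] by (simp add: optimal_policy_def v[symmetric])
  qed
  have c: "(\<lambda>n. v n x) \<longlonglongrightarrow> optimal_value D x \<and> (\<lambda>n. ve n x) \<longlonglongrightarrow> optimal_value D x \<and>
      (\<lambda>n. Top D (ve n) x) \<longlonglongrightarrow> optimal_value D x" if x: "x \<in> X" for x
  proof -
    \<comment> \<open>The limit is introduced through the envelopes, which decrease because ve (n+1)
      \<le> v (n+1) \<le> T (ve n) \<le> ve n. The same chain squeezes the other two
      sequences.\<close>
    define L where "L y = (INF n. ve n y)" for y
    have e_lim: "(\<lambda>n. ve n y) \<longlonglongrightarrow> L y" if y: "y \<in> X" for y
      unfolding L_def
    proof (rule LIMSEQ_decseq_INF)
      show "bdd_below (range (\<lambda>n. ve n y))"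
      proof (rule bdd_belowI2)
        show "- (c * W y) \<le> ve n y" for n using W_boundedD(2)[OF eb[of n] y] by linarith
      qed
      show "decseq (\<lambda>n. ve n y)"
        using a1[OF y] a2[OF y] a3[OF y] by (intro decseq_SucI) (meson order_trans)
    qed
    have eS_lim: "(\<lambda>n. ve (Suc n) y) \<longlonglongrightarrow> L y" if "y \<in> X" for y
      using e_lim[OF that] by (rule LIMSEQ_Suc)
    have T_lim: "(\<lambda>n. Top D (ve n) y) \<longlonglongrightarrow> L y" if y: "y \<in> X" for y
    proof (rule tendsto_sandwich[OF always_eventually[OF allI] always_eventually[OF allI] eS_lim[OF y] e_lim[OF y]])
      show "ve (Suc n) y \<le> Top D (ve n) y" "Top D (ve n) y \<le> ve n y" for n
        using order_trans[OF a1[OF y] a3[OF y]] a2[OF y] .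
    qed
    have vS_lim: "(\<lambda>n. v (Suc n) y) \<longlonglongrightarrow> L y" if y: "y \<in> X" for y
    proof (rule tendsto_sandwich[OF always_eventually[OF allI] always_eventually[OF allI] eS_lim[OF y] T_lim[OF y]])
      show "ve (Suc n) y \<le> v (Suc n) y" "v (Suc n) y \<le> Top D (ve n) y" for n
        using a1[OF y] a3[OF y] .
    qed
    \<comment> \<open>The chain bounds \<open>v\<close> from above only from index 1 on; the first
      term does not affect the limit.\<close>
    have v_lim: "(\<lambda>n. v n y) \<longlonglongrightarrow> L y" if "y \<in> X" for y
      by (rule LIMSEQ_imp_Suc[OF vS_lim[OF that]])
    have Lb: "W_bounded c L"
      unfolding W_bounded_def
    proof (intro conjI ballI)
      show "L \<in> borel_measurable \<X>"
        by (rule borel_measurable_LIMSEQ_real[OF _ W_boundedD(1)[OF eb]]) (rule e_lim, simp add: space_X)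
      show "\<bar>L y\<bar> \<le> c * W y" if "y \<in> X" for y
        using W_boundedD(2)[OF eb that] by (intro LIMSEQ_le_const2[OF tendsto_rabs[OF e_lim[OF that]]]) auto
    qed
    \<comment> \<open>At a fixed pair \<open>z\<close> both sides of T (ve n) \<le> C + \<alpha> Q
      (ve n) converge: the left by \<open>T_lim\<close>, the right by dominated convergence under c
      W.\<close>
    have "L (fst z) \<le> cost D z + \<alpha> * Qop D L z" if z: "z \<in> G" for z
    proof (rule LIMSEQ_le[OF T_lim[OF G_D(1)[OF z]]])
      have "(\<lambda>n. Qop D (ve n) z) \<longlonglongrightarrow> Qop D L z"
        by (rule Qop_tendsto[OF W_boundedD(1)[OF eb] Lb W_boundedD(2)[OF eb] e_lim z])
      then show "(\<lambda>n. cost D z + \<alpha> * Qop D (ve n) z) \<longlonglongrightarrow> cost D z + \<alpha> * Qop D L z"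
        by (intro tendsto_intros)
      show "\<exists>N. \<forall>n\<ge>N. Top D (ve n) (fst z) \<le> cost D z + \<alpha> * Qop D (ve n) z"
        using Top_le[OF eb z] by auto
    qed
    then have "L x \<le> optimal_value D x" by (rule le_optimal_value[OF Lb _ x])
    moreover have "optimal_value D x \<le> L x"
      using opt_v[OF x] by (intro LIMSEQ_le_const[OF v_lim[OF x]]) auto
    ultimately have "L x = optimal_value D x" by (rule antisym)
    then show ?thesis using e_lim[OF x] T_lim[OF x] v_lim[OF x] by simp
  qed
  show ?thesis
    using a1 a2 a3 b c by blast
qed

end
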